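(* There exists a polynomial-time $(f+1)^D$-approximation algorithm for the $D$-round TCAND problem, where $1\le D\le n$ and, for an input $(V,\mathcal{F},T)$ with $|V|=n$, $f=\max_{i\in V}|\{X\subseteq V: (X\to i)\in\mathcal{F}\}|$.
   Context: Let $V=[n]=\{1,\dots,n\}$ be a finite set of attributes (variables). A functional dependency (FD) over $V$ is an expression $LS\to i$ with $LS\subseteq V$ and $i\in V$ (an FD with several attributes on the right-hand side is identified with the corresponding set of FDs with single-attribute right-hand sides). $\mathcal{F}$ is a finite set of FDs and $T\subseteq V$ is a set of target variables. $D$-round TCAND: given $\mathcal{F}$ and $T$, find a set $X\subseteq V$ of minimum cardinality such that $T$ can be inferred from $X$ by at most $D$ rounds of FD inference, that is, $T\subseteq X_D$, where $X_0=X$ and $X_{k+1}=X_k\cup\{i\in V:\exists (LS\to i)\in\mathcal{F},\ LS\subseteq X_k\}$. Such a set $X$ is called feasible. A $\rho$-approximation algorithm always outputs a feasible set of cardinality at most $\rho\cdot\mathrm{OPT}$, where $\mathrm{OPT}$ is the minimum cardinality of a feasible set. *)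

theory Defs
  imports Complex_Main "HOL-Computational_Algebra.Polynomial"
begin

section \<open>Functional dependencies and the \<open>D\<close>-round TCAND problem\<close>

text \<open>The pair \<open>(LS, i)\<close> is the dependency \<open>LS \<rightarrow> i\<close>; the attributes are \<open>{1..n}\<close>.\<close>

type_synonym fd = "nat set \<times> nat"

fun infer :: "fd set \<Rightarrow> nat set \<Rightarrow> nat \<Rightarrow> nat set" where
  "infer F X 0 = X"
| "infer F X (Suc k) = infer F X k \<union> {i. \<exists>LS. (LS, i) \<in> F \<and> LS \<subseteq> infer F X k}"

definition tcand_instance :: "nat \<Rightarrow> nat \<Rightarrow> fd set \<Rightarrow> nat set \<Rightarrow> bool" where
  "tcand_instance D n F T \<longleftrightarrow>
     1 \<le> D \<and> D \<le> n \<and> finite F \<and> (\<forall>(LS, i) \<in> F. LS \<subseteq> {1..n} \<and> i \<in> {1..n}) \<and> T \<subseteq> {1..n}"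

definition feasible :: "nat \<Rightarrow> nat \<Rightarrow> fd set \<Rightarrow> nat set \<Rightarrow> nat set \<Rightarrow> bool" where
  "feasible D n F T X \<longleftrightarrow> X \<subseteq> {1..n} \<and> T \<subseteq> infer F X D"

definition opt :: "nat \<Rightarrow> nat \<Rightarrow> fd set \<Rightarrow> nat set \<Rightarrow> nat" where
  "opt D n F T = Min (card ` {X. feasible D n F T X})"

definition max_fds :: "nat \<Rightarrow> fd set \<Rightarrow> nat" where
  "max_fds n F = Max ((\<lambda>i. card {X. X \<subseteq> {1..n} \<and> (X, i) \<in> F}) ` {1..n})"

lemma infer_superset: "X \<subseteq> infer F X k"
  by (induction k) auto

lemma opt_attained:
  assumes "T \<subseteq> {1..n}"
  shows "\<exists>X. feasible D n F T X \<and> card X = opt D n F T"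
    and "feasible D n F T Y \<Longrightarrow> opt D n F T \<le> card Y"
proof -
  have "{X. feasible D n F T X} \<subseteq> Pow {1..n}"
    by (auto simp: feasible_def)
  then have fin: "finite (card ` {X. feasible D n F T X})"
    by (meson finite_Pow_iff finite_atLeastAtMost finite_imageI finite_subset)
  have "feasible D n F T T"
    using assms infer_superset by (auto simp: feasible_def)
  then have "opt D n F T \<in> card ` {X. feasible D n F T X}"
    unfolding opt_def using fin by (intro Min_in) auto
  then show "\<exists>X. feasible D n F T X \<and> card X = opt D n F T"
    by auto
  show "feasible D n F T Y \<Longrightarrow> opt D n F T \<le> card Y"
    unfolding opt_def using fin by (intro Min_le) auto
qed


section \<open>Random access machine programs with running time\<close>

text \<open>
  The machine model is the random access machine with additive arithmetic (addition and
  truncated subtraction, no multiplication), indirect addressing and unit cost per instruction,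
  written with structured control flow. A state consists of registers, of which a program uses
  only the finitely many it mentions, and an unbounded memory. Since one step can at most double
  the largest number present, numbers have polynomially many bits in polynomial time, so this
  model defines the same polynomial-time algorithms as the Turing machine.
\<close>

type_synonym state = "(nat \<Rightarrow> nat) \<times> (nat \<Rightarrow> nat)"

datatype com =
    Skip
  | Const nat nat
  | Add nat nat nat
  | Sub nat nat nat
  | Load nat nat
  | Store nat nat
  | Seq com com
  | If nat com com
  | While nat com

text \<open>\<open>exec c s t s'\<close>: program \<open>c\<close> started in \<open>s\<close> halts in \<open>s'\<close> after exactly \<open>t\<close> steps.
  \<open>Load\<close> and \<open>Store\<close> address the memory through the contents of a register.\<close>

inductive exec :: "com \<Rightarrow> state \<Rightarrow> nat \<Rightarrow> state \<Rightarrow> bool" where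
  Skip: "exec Skip s 1 s"
| Const: "exec (Const r k) (R, M) 1 (R(r := k), M)"
| Add: "exec (Add r a b) (R, M) 1 (R(r := R a + R b), M)"
| Sub: "exec (Sub r a b) (R, M) 1 (R(r := R a - R b), M)"
| Load: "exec (Load r a) (R, M) 1 (R(r := M (R a)), M)"
| Store: "exec (Store a b) (R, M) 1 (R, M(R a := R b))"
| Seq: "exec c1 s t1 s' \<Longrightarrow> exec c2 s' t2 s'' \<Longrightarrow> exec (Seq c1 c2) s (t1 + t2) s''"
| IfTrue: "fst s r \<noteq> 0 \<Longrightarrow> exec c1 s t s' \<Longrightarrow> exec (If r c1 c2) s (Suc t) s'"
| IfFalse: "fst s r = 0 \<Longrightarrow> exec c2 s t s' \<Longrightarrow> exec (If r c1 c2) s (Suc t) s'"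
| WhileFalse: "fst s r = 0 \<Longrightarrow> exec (While r c) s 1 s"
| WhileTrue: "fst s r \<noteq> 0 \<Longrightarrow> exec c s t1 s' \<Longrightarrow> exec (While r c) s' t2 s'' \<Longrightarrow>
    exec (While r c) s (Suc (t1 + t2)) s''"

inductive_cases exec_SkipE: "exec Skip s t s'"
inductive_cases exec_ConstE: "exec (Const r k) s t s'"
inductive_cases exec_AddE: "exec (Add r a b) s t s'"
inductive_cases exec_SubE: "exec (Sub r a b) s t s'"
inductive_cases exec_LoadE: "exec (Load r a) s t s'"
inductive_cases exec_StoreE: "exec (Store a b) s t s'"
inductive_cases exec_SeqE: "exec (Seq c1 c2) s t s'"
inductive_cases exec_IfE: "exec (If r c1 c2) s t s'"
inductive_cases exec_WhileE: "exec (While r c) s t s'"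

lemma exec_deterministic:
  "exec c s t s' \<Longrightarrow> exec c s u s'' \<Longrightarrow> u = t \<and> s'' = s'"
proof (induction arbitrary: u s'' rule: exec.induct)
  case (Seq c1 s t1 s' c2 t2 s2)
  from Seq.prems show ?case by (rule exec_SeqE) (metis Seq.IH)
next
  case (IfTrue s r c1 t s' c2)
  from IfTrue.prems show ?case by (rule exec_IfE) (use IfTrue.hyps in \<open>auto dest!: IfTrue.IH\<close>)
next
  case (IfFalse s r c2 t s' c1)
  from IfFalse.prems show ?case by (rule exec_IfE) (use IfFalse.hyps in \<open>auto dest!: IfFalse.IH\<close>)
next
  case (WhileFalse s r c)
  from WhileFalse.prems show ?case by (rule exec_WhileE) (use WhileFalse.hyps in auto)
next
  case (WhileTrue s r c t1 s' t2 s2)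
  from WhileTrue.prems WhileTrue.hyps(1) obtain v1 v2 m where
    "exec c s v1 m" "exec (While r c) m v2 s''" and u: "u = Suc (v1 + v2)"
    by (auto elim: exec_WhileE)
  then have "v1 = t1" "v2 = t2" "s'' = s2"
    using WhileTrue.IH by blast+
  with u show ?case by simp
qed (auto elim: exec_SkipE exec_ConstE exec_AddE exec_SubE exec_LoadE exec_StoreE)

text \<open>A word \<open>w\<close> is stored with its length in cell \<open>0\<close> and its entries in cells
  \<open>1, \<dots>, length w\<close>; the same convention is used for input and output.\<close>

definition init_state :: "nat list \<Rightarrow> state" where
  "init_state w = ((\<lambda>_. 0), (\<lambda>a. if a = 0 then length w else if a \<le> length w then w ! (a - 1) else 0))"

definition result :: "state \<Rightarrow> nat list" where
  "result s = map (snd s) [1..<Suc (snd s 0)]"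

definition outputs :: "com \<Rightarrow> nat list \<Rightarrow> nat list \<Rightarrow> bool" where
  "outputs A w v \<longleftrightarrow> (\<exists>t s. exec A (init_state w) t s \<and> result s = v)"

definition poly_time_on :: "nat list set \<Rightarrow> com \<Rightarrow> bool" where
  "poly_time_on I A \<longleftrightarrow>
     (\<exists>p :: nat poly. \<forall>w \<in> I. \<exists>t s. exec A (init_state w) t s \<and> t \<le> poly p (length w))"


section \<open>Approximation algorithms for \<open>D\<close>-round TCAND\<close>

text \<open>
  Sets of attributes are given by their characteristic vectors, so the length of an encoded
  instance is at least \<open>n\<close> and polynomial in \<open>n\<close> and the number of dependencies. All entries of
  an encoded instance are bounded by its length, so the length and the number of bits are
  polynomially related. The set of dependencies is presented as a list in arbitrary order.
\<close>

definition bits :: "nat \<Rightarrow> nat set \<Rightarrow> nat list" where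
  "bits n X = map (\<lambda>i. if i \<in> X then 1 else 0) [1..<Suc n]"

definition encode :: "nat \<Rightarrow> nat \<Rightarrow> fd list \<Rightarrow> nat set \<Rightarrow> nat list" where
  "encode D n fs T =
     [D, n] @ bits n T @ [length fs] @ concat (map (\<lambda>(LS, i). bits n LS @ [i]) fs)"

definition tcand_inputs :: "nat list set" where
  "tcand_inputs = {encode D n fs T | D n fs T. tcand_instance D n (set fs) T \<and> distinct fs}"

definition tcand_approximation ::
  "(nat \<Rightarrow> nat \<Rightarrow> fd set \<Rightarrow> nat set \<Rightarrow> real) \<Rightarrow> com \<Rightarrow> bool" where
  "tcand_approximation \<rho> A \<longleftrightarrow>
     (\<forall>D n fs T. tcand_instance D n (set fs) T \<and> distinct fs \<longrightarrow>
        (\<exists>X. outputs A (encode D n fs T) (bits n X) \<and> feasible D n (set fs) T X \<and>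
             real (card X) \<le> \<rho> D n (set fs) T * real (opt D n (set fs) T)))"

end

theory Submission
  imports Defs
begin

text \<open>
  As long as \<open>X\<close> is infeasible, some target \<open>t\<close> is not inferred from \<open>X\<close> within \<open>D\<close> rounds. Let
  \<open>C\<^sub>1 = {t}\<close>, and obtain \<open>C\<^sub>s\<^sub>+\<^sub>1\<close> from \<open>C\<^sub>s\<close> by adding, for every dependency whose right-hand side is
  in \<open>C\<^sub>s\<close>, one attribute of its left-hand side that is not inferred within \<open>D - s\<close> rounds. Then
  \<open>C\<^sub>D\<^sub>+\<^sub>1\<close> is disjoint from \<open>X\<close>, has at most \<open>(f + 1)\<^sup>D\<close> elements, and meets every feasible set
  \<open>Z\<close>: otherwise, by induction on \<open>k\<close>, no attribute of \<open>C\<^sub>D\<^sub>+\<^sub>1\<^sub>-\<^sub>k\<close> would be inferred from \<open>Z\<close> within \<open>k\<close>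
  rounds. Adding all of \<open>C\<^sub>D\<^sub>+\<^sub>1\<close> to \<open>X\<close> and repeating at most \<open>n\<close> times yields a feasible \<open>X\<close> that is
  a disjoint union of such sets; their number is at most the optimum, because an optimal solution
  meets each of them.
\<close>

section \<open>Total correctness with a syntactic time bound\<close>

text \<open>If every loop in \<open>c\<close> makes fewer than \<open>K\<close> iterations, then \<open>c\<close> halts within
  \<open>steps K c\<close> steps, and this is a polynomial in \<open>K\<close>.\<close>

fun steps :: "nat \<Rightarrow> com \<Rightarrow> nat" where
  "steps K (Seq c1 c2) = steps K c1 + steps K c2"
| "steps K (If r c1 c2) = Suc (steps K c1 + steps K c2)"
| "steps K (While r c) = K * Suc (steps K c)"
| "steps K _ = 1"

lemma steps_poly: "\<exists>p :: nat poly. \<forall>K. steps K c = poly p K"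
proof (induction c)
  case (Seq c1 c2)
  then obtain p q :: "nat poly" where "\<forall>K. steps K c1 = poly p K" "\<forall>K. steps K c2 = poly q K"
    by blast
  then show ?case by (intro exI[of _ "p + q"]) simp
next
  case (If r c1 c2)
  then obtain p q :: "nat poly" where "\<forall>K. steps K c1 = poly p K" "\<forall>K. steps K c2 = poly q K"
    by blast
  then show ?case by (intro exI[of _ "1 + p + q"]) simp
next
  case (While r c)
  then obtain p :: "nat poly" where "\<forall>K. steps K c = poly p K"
    by blast
  then show ?case by (intro exI[of _ "[:0, 1:] * (1 + p)"]) simp
qed (rule exI[of _ 1]; simp)+

definition hoare :: "nat \<Rightarrow> (state \<Rightarrow> bool) \<Rightarrow> com \<Rightarrow> (state \<Rightarrow> bool) \<Rightarrow> bool" where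
  "hoare K P c Q \<longleftrightarrow> (\<forall>s. P s \<longrightarrow> (\<exists>t s'. exec c s t s' \<and> t \<le> steps K c \<and> Q s'))"

lemma hoare_Seq: "hoare K P c1 Q \<Longrightarrow> hoare K Q c2 R \<Longrightarrow> hoare K P (Seq c1 c2) R"
  unfolding hoare_def by (metis add_mono exec.Seq steps.simps(1))

lemma hoare_conseq:
  "hoare K P c Q \<Longrightarrow> (\<And>s. P' s \<Longrightarrow> P s) \<Longrightarrow> (\<And>s. Q s \<Longrightarrow> Q' s) \<Longrightarrow> hoare K P' c Q'"
  unfolding hoare_def by metis

text \<open>The precondition \<open>P'\<close> may depend on the state, so values that
  \<open>P\<close> quantifies existentially, such as the stored arrays, can be fixed before a triple
  is proved.\<close>

lemma hoare_cases:
  assumes "\<And>R M. P (R, M) \<Longrightarrow> \<exists>P'. P' (R, M) \<and> hoare K P' c Q"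
  shows "hoare K P c Q"
  using assms unfolding hoare_def by (metis surj_pair)

text \<open>The index of the invariant is the content of the loop register, which is thus both the
  variant and the number of iterations left.\<close>

lemma hoare_While:
  assumes body: "\<And>k. Suc k \<le> N \<Longrightarrow> hoare K (I (Suc k)) c (I k)"
    and counter: "\<And>k s. I k s \<Longrightarrow> fst s r = k"
    and N: "N < K"
  shows "hoare K (I N) (While r c) (I 0)"
proof -
  have "\<exists>t s'. exec (While r c) s t s' \<and> t \<le> k * Suc (steps K c) + 1 \<and> I 0 s'"
    if "I k s" "k \<le> N" for k s
    using that
  proof (induction k arbitrary: s)
    case 0
    then have "exec (While r c) s 1 s"
      using counter by (intro exec.WhileFalse) auto
    then show ?case using 0(1) by (intro exI[of _ 1] exI[of _ s]) simp
  next
    case (Suc k)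
    from body[OF Suc.prems(2)] Suc.prems(1) obtain t1 s1 where
      1: "exec c s t1 s1" "t1 \<le> steps K c" "I k s1"
      unfolding hoare_def by blast
    from Suc.IH[OF 1(3)] Suc.prems(2) obtain t2 s2 where
      2: "exec (While r c) s1 t2 s2" "t2 \<le> k * Suc (steps K c) + 1" "I 0 s2"
      by auto
    have "exec (While r c) s (Suc (t1 + t2)) s2"
      using counter[OF Suc.prems(1)] 1(1) 2(1) by (intro exec.WhileTrue) auto
    then show ?case using 1(2) 2(2,3) by (intro exI conjI) auto
  qed
  \<comment> \<open>The summand \<open>1\<close> pays for the final failing test; it fits into the
    spare iteration that \<open>N < K\<close> leaves.\<close>
  moreover have "N * Suc (steps K c) + 1 \<le> steps K (While r c)"
  proof -
    have "N * Suc (steps K c) + 1 \<le> Suc N * Suc (steps K c)"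
      by simp
    also have "\<dots> \<le> K * Suc (steps K c)"
      using N by (intro mult_right_mono) auto
    finally show ?thesis by simp
  qed
  ultimately show ?thesis
    unfolding hoare_def by (meson order_refl order_trans)
qed

section \<open>Loop-free programs as state transformers\<close>

fun loop_free :: "com \<Rightarrow> bool" where
  "loop_free (Seq c1 c2) = (loop_free c1 \<and> loop_free c2)"
| "loop_free (If r c1 c2) = (loop_free c1 \<and> loop_free c2)"
| "loop_free (While r c) = False"
| "loop_free _ = True"

text \<open>The last equation is correct for \<open>Skip\<close> and a mere placeholder for
  \<open>While\<close>; hence the assumption \<open>loop_free\<close> in
  \<open>exec_run\<close>.\<close>

fun run :: "com \<Rightarrow> state \<Rightarrow> state" where
  "run (Const r k) (R, M) = (R(r := k), M)"
| "run (Add r a b) (R, M) = (R(r := R a + R b), M)"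
| "run (Sub r a b) (R, M) = (R(r := R a - R b), M)"
| "run (Load r a) (R, M) = (R(r := M (R a)), M)"
| "run (Store a b) (R, M) = (R, M(R a := R b))"
| "run (Seq c1 c2) s = run c2 (run c1 s)"
| "run (If r c1 c2) s = (if fst s r \<noteq> 0 then run c1 s else run c2 s)"
| "run _ s = s"

lemma exec_run: "loop_free c \<Longrightarrow> \<exists>t. exec c s t (run c s) \<and> t \<le> steps K c"
proof (induction c arbitrary: s)
  case (Seq c1 c2)
  then show ?case by (fastforce intro: exec.Seq add_mono)
next
  case (If r c1 c2)
  then obtain t1 t2 where "exec c1 s t1 (run c1 s)" "t1 \<le> steps K c1"
    "exec c2 s t2 (run c2 s)" "t2 \<le> steps K c2"
    by (metis loop_free.simps(2))
  then show ?case
    by (cases "fst s r = 0") (force intro: exec.IfTrue exec.IfFalse)+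
qed (cases s; auto intro: exec.intros)+

lemma hoare_run:
  assumes "loop_free c" "\<And>R M. P (R, M) \<Longrightarrow> Q (run c (R, M))"
  shows "hoare K P c Q"
  unfolding hoare_def
proof (intro allI impI)
  fix s assume "P s"
  moreover obtain R M where "s = (R, M)" by fastforce
  ultimately show "\<exists>t s'. exec c s t s' \<and> t \<le> steps K c \<and> Q s'"
    using exec_run[OF assms(1), of s K] assms(2) by blast
qed


section \<open>The program\<close>

text \<open>Registers: \<open>0\<close> and \<open>1\<close> hold the constants \<open>0\<close> and \<open>1\<close>; \<open>2\<close> is \<open>n\<close>; \<open>3\<close> is \<open>D\<close>; \<open>4\<close> and \<open>5\<close>
  are the base addresses of the arrays \<open>lv\<close> and \<open>mk\<close>, placed behind the input; \<open>6\<close> is the base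
  address of the dependencies; \<open>7\<close> is \<open>n + 1\<close>; \<open>8\<close> is the number of dependencies; \<open>9\<close> is \<open>D + 1\<close>.
  Then come the repetition counter \<open>10\<close>, the threshold \<open>11\<close>, the round counter \<open>12\<close>, the
  dependency counter \<open>13\<close> and the pointer \<open>14\<close> to the current bit vector.\<close>

fun seq :: "com list \<Rightarrow> com" where
  "seq [] = Skip"
| "seq [c] = c"
| "seq (c # cs) = Seq c (seq cs)"

definition setup_prog :: com where
  "setup_prog = seq [Const 0 0, Const 1 1, Const 2 2, Load 2 2, Load 3 1, Load 4 0, Add 5 4 2,
     Const 6 3, Add 6 6 2, Add 7 2 1, Load 8 6, Add 9 3 1, Add 10 2 0]"

text \<open>Register \<open>16\<close> receives a member \<open>j\<close> of the set at \<open>14\<close> with \<open>lv j\<close> at most the threshold,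
  or \<open>0\<close> if there is none.\<close>

definition scan_body :: com where
  "scan_body = seq [Add 17 14 15, Load 17 17,
     If 17 (seq [Add 18 4 15, Load 18 18, Sub 18 18 11, If 18 Skip (Add 16 15 0)]) Skip,
     Sub 15 15 1]"

definition scan_prog :: com where
  "scan_prog = Seq (seq [Const 16 0, Add 15 2 0]) (While 15 scan_body)"

definition fds_prog :: "com \<Rightarrow> com" where
  "fds_prog c = Seq (seq [Add 13 8 0, Add 14 6 0])
     (While 13 (Seq scan_prog (Seq (seq [Add 14 14 7, Load 19 14]) (Seq c (Sub 13 13 1)))))"

definition infer_step :: com where
  "infer_step = If 16 Skip (seq [Add 17 4 19, Load 18 17, If 18 Skip (Store 17 11)])"

definition infer_prog :: com where
  "infer_prog = Seq (Add 11 3 0) (While 11 (Seq (fds_prog infer_step) (Sub 11 11 1)))"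

definition target_prog :: com where
  "target_prog = Seq (seq [Const 14 2, Const 11 0])
     (Seq scan_prog (If 16 (seq [Add 17 5 16, Store 17 1]) Skip))"

definition mark_step :: com where
  "mark_step = seq [Add 17 5 19, Load 17 17,
     If 17 (seq [Sub 17 17 11,
       If 17 Skip (seq [Add 17 5 16, Load 18 17, If 18 Skip (seq [Add 18 11 1, Store 17 18])])]) Skip]"

definition mark_prog :: com where
  "mark_prog = Seq (Add 12 3 0)
     (While 12 (Seq (Sub 11 9 12) (Seq (fds_prog mark_step) (Sub 12 12 1))))"

definition reset_body :: com where
  "reset_body = seq [Add 17 5 15, Load 18 17, Store 17 0, Add 17 4 15,
     If 18 (Store 17 9) (seq [Load 18 17, Sub 18 18 3, If 18 Skip (Store 17 0)]), Sub 15 15 1]"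

definition reset_prog :: com where
  "reset_prog = Seq (Add 15 2 0) (While 15 reset_body)"

definition output_body :: com where
  "output_body = seq [Add 17 4 15, Load 18 17, If 18 (Store 15 1) (Store 15 0), Sub 15 15 1]"

definition output_prog :: com where
  "output_prog = Seq (Add 15 2 0) (Seq (While 15 output_body) (Store 0 2))"

definition main_body :: com where
  "main_body = Seq infer_prog (Seq target_prog (Seq mark_prog (Seq reset_prog (Sub 10 10 1))))"

definition tcand_prog :: com where
  "tcand_prog = Seq setup_prog (Seq (While 10 main_body) output_prog)"


section \<open>Combinatorics of one repetition\<close>

lemma infer_mono: "k \<le> l \<Longrightarrow> infer F X k \<subseteq> infer F X l"
  by (induction rule: dec_induct) auto

lemma nth_concat_uniform:
  assumes "\<forall>xs \<in> set xss. length xs = l" "q < length xss" "j < l"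
  shows "concat xss ! (q * l + j) = xss ! q ! j"
  using assms
proof (induction xss arbitrary: q)
  case (Cons xs xss)
  then show ?case
    by (cases q) (auto simp: nth_append)
qed simp

lemma length_concat_uniform:
  "\<forall>xs \<in> set xss. length xs = l \<Longrightarrow> length (concat xss) = length xss * l"
  by (induction xss) auto

section \<open>Levels of inference in a fixed instance\<close>

locale tcand =
  fixes D n :: nat and fs :: "fd list" and T :: "nat set"
  assumes inst: "tcand_instance D n (set fs) T" and dist: "distinct fs"
begin

abbreviation "V \<equiv> {1..n}"
abbreviation "F \<equiv> set fs"
abbreviation "m \<equiv> length fs"
definition "f = max_fds n F"
definition "w = encode D n fs T"
definition "L = length w"

lemma fdD: "(LS, i) \<in> F \<Longrightarrow> LS \<subseteq> V \<and> 1 \<le> i \<and> i \<le> n"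
  using inst by (auto simp: tcand_instance_def)

lemma D_bounds: "1 \<le> D" "D \<le> n"
  using inst by (auto simp: tcand_instance_def)

lemma T_subset: "T \<subseteq> V"
  using inst by (auto simp: tcand_instance_def)

text \<open>Within round \<open>r\<close>, after the first \<open>q\<close> dependencies: a nonzero \<open>lv j\<close> records that \<open>j\<close> is
  inferred from \<open>X\<close> within \<open>D + 1 - lv j\<close> rounds.\<close>

definition levels :: "nat set \<Rightarrow> nat \<Rightarrow> nat \<Rightarrow> (nat \<Rightarrow> nat) \<Rightarrow> bool" where
  "levels X r q lv \<longleftrightarrow>
     (\<forall>j \<in> V. lv j \<noteq> 0 \<longrightarrow> r \<le> lv j \<and> lv j \<le> Suc D \<and> j \<in> infer F X (Suc D - lv j)) \<and>
     (\<forall>j \<in> V. lv j = Suc D \<longleftrightarrow> j \<in> X) \<and>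
     (\<forall>LS i. (LS, i) \<in> F \<longrightarrow> (\<forall>r'. r < r' \<longrightarrow> r' \<le> D \<longrightarrow> (\<forall>j \<in> LS. r' < lv j) \<longrightarrow> r' \<le> lv i)) \<and>
     (\<forall>LS i. (LS, i) \<in> set (take q fs) \<longrightarrow> (\<forall>j \<in> LS. r < lv j) \<longrightarrow> r \<le> lv i)"

lemma levelsD:
  assumes "levels X r q lv"
  shows "j \<in> V \<Longrightarrow> lv j \<noteq> 0 \<Longrightarrow> r \<le> lv j \<and> lv j \<le> Suc D \<and> j \<in> infer F X (Suc D - lv j)"
    and "j \<in> V \<Longrightarrow> lv j = Suc D \<longleftrightarrow> j \<in> X"
    and "(LS, i) \<in> F \<Longrightarrow> r < r' \<Longrightarrow> r' \<le> D \<Longrightarrow> \<forall>j \<in> LS. r' < lv j \<Longrightarrow> r' \<le> lv i"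
    and "(LS, i) \<in> set (take q fs) \<Longrightarrow> \<forall>j \<in> LS. r < lv j \<Longrightarrow> r \<le> lv i"
  using assms unfolding levels_def by blast+

lemma levels_init:
  assumes "\<forall>j \<in> V. lv j = (if j \<in> X then Suc D else 0)"
  shows "levels X D 0 lv"
  using assms by (auto simp: levels_def)

text \<open>Premises passing the test \<open>r < lv j\<close> date from earlier rounds, so they are
  inferred within \<open>D - r\<close> rounds and the conclusion within one more. The guard
  \<open>lv i = 0\<close> preserves levels from earlier rounds. Raising a level from
  \<open>0\<close> to \<open>r\<close> changes no test \<open>r' < lv j\<close> with
  \<open>r \<le> r'\<close>, so the closure clauses survive.\<close>

lemma levels_step:
  assumes lv: "levels X r q lv" and q: "q < m" "fs ! q = (LS, i)" and r: "1 \<le> r" "r \<le> D"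
  shows "levels X r (Suc q) (if lv i = 0 \<and> (\<forall>j \<in> LS. r < lv j) then lv(i := r) else lv)"
proof -
  have fd: "(LS, i) \<in> F" using q by (metis nth_mem)
  have take: "set (take (Suc q) fs) = insert (LS, i) (set (take q fs))"
    using q by (simp add: take_Suc_conv_app_nth)
  show ?thesis
  proof (cases "lv i = 0 \<and> (\<forall>j \<in> LS. r < lv j)")
    case True
    have "j \<in> infer F X (D - r)" if "j \<in> LS" for j
    proof -
      have "j \<in> infer F X (Suc D - lv j)"
        using True that fdD[OF fd] levelsD(1)[OF lv, of j] by fastforce
      then show ?thesis
        using infer_mono[of "Suc D - lv j" "D - r"] True that by fastforce
    qed
    then have "i \<in> infer F X (Suc (D - r))"
      using fd by auto
    then have i: "i \<in> infer F X (Suc D - r)"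
      using r by (simp add: Suc_diff_le)
    define lv' where "lv' = lv(i := r)"
    have less: "r' < lv' j \<longleftrightarrow> r' < lv j" if "r \<le> r'" for r' j
      using that True by (auto simp: lv'_def)
    have le: "lv j \<le> lv' j" for j
      using True by (auto simp: lv'_def)
    have "levels X r (Suc q) lv'"
      unfolding levels_def take
    proof (intro conjI)
      show "\<forall>j \<in> V. lv' j \<noteq> 0 \<longrightarrow> r \<le> lv' j \<and> lv' j \<le> Suc D \<and> j \<in> infer F X (Suc D - lv' j)"
        using levelsD(1)[OF lv] i r by (simp add: lv'_def)
      have "lv' j = Suc D \<longleftrightarrow> lv j = Suc D" for j
        using r True by (auto simp: lv'_def)
      then show "\<forall>j \<in> V. lv' j = Suc D \<longleftrightarrow> j \<in> X"
        using levelsD(2)[OF lv] by simp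
      show "\<forall>LS i. (LS, i) \<in> F \<longrightarrow> (\<forall>r'. r < r' \<longrightarrow> r' \<le> D \<longrightarrow> (\<forall>j \<in> LS. r' < lv' j) \<longrightarrow> r' \<le> lv' i)"
        using levelsD(3)[OF lv] le less by (meson less_imp_le order_trans)
      show "\<forall>LS' i'. (LS', i') \<in> insert (LS, i) (set (take q fs)) \<longrightarrow>
          (\<forall>j \<in> LS'. r < lv' j) \<longrightarrow> r \<le> lv' i'"
      proof (intro allI impI)
        fix LS' i' assume *: "(LS', i') \<in> insert (LS, i) (set (take q fs))" "\<forall>j \<in> LS'. r < lv' j"
        show "r \<le> lv' i'"
        proof (cases "(LS', i') = (LS, i)")
          case False
          then have "r \<le> lv i'"
            using * levelsD(4)[OF lv] less by blast
          then show ?thesis using le order_trans by blast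
        qed (simp add: lv'_def)
      qed
    qed
    then show ?thesis using True by (simp add: lv'_def)
  next
    case False
    then have "(\<forall>j \<in> LS. r < lv j) \<longrightarrow> r \<le> lv i"
      using levelsD(1)[OF lv, of i] False fdD[OF fd] by auto
    then have "levels X r (Suc q) lv"
      using lv unfolding levels_def take by blast
    then show ?thesis unfolding if_not_P[OF False] .
  qed
qed

text \<open>Once all \<open>m\<close> dependencies are processed, the clause for round
  \<open>Suc r\<close> extends the clause for higher thresholds down to \<open>Suc r\<close>; the
  next round's own clause is vacuous at \<open>q = 0\<close>.\<close>

lemma levels_next:
  assumes lv: "levels X (Suc r) m lv"
  shows "levels X r 0 lv"
  unfolding levels_def
proof (intro conjI)
  show "\<forall>j \<in> V. lv j \<noteq> 0 \<longrightarrow> r \<le> lv j \<and> lv j \<le> Suc D \<and> j \<in> infer F X (Suc D - lv j)"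
    using lv unfolding levels_def by (meson Suc_leD)
  show "\<forall>j \<in> V. lv j = Suc D \<longleftrightarrow> j \<in> X"
    using lv by (simp add: levels_def)
  have "r' \<le> lv i" if "(LS, i) \<in> F" "r < r'" "r' \<le> D" "\<forall>j \<in> LS. r' < lv j" for LS i r'
  proof (cases "r' = Suc r")
    case True
    then show ?thesis using levelsD(4)[OF lv, of LS i] that by simp
  next
    case False
    then have "Suc r < r'" using that by simp
    then show ?thesis using levelsD(3)[OF lv] that by blast
  qed
  then show "\<forall>LS i. (LS, i) \<in> F \<longrightarrow> (\<forall>r'. r < r' \<longrightarrow> r' \<le> D \<longrightarrow> (\<forall>j \<in> LS. r' < lv j) \<longrightarrow> r' \<le> lv i)"
    by blast
qed simp

section \<open>Marks: growing a hitting set from an uninferred target\<close>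

definition marked :: "(nat \<Rightarrow> nat) \<Rightarrow> nat \<Rightarrow> nat set" where
  "marked mk s = {j \<in> V. 0 < mk j \<and> mk j \<le> s}"

text \<open>In round \<open>s\<close>, \<open>marked mk s\<close> consists of attributes that are not inferred within \<open>D + 1 - s\<close>
  rounds; each dependency with its right-hand side among them gets a premise marked \<open>s + 1\<close> or
  less, which accounts for at most \<open>f\<close> new marks per member.\<close>

definition marks :: "(nat \<Rightarrow> nat) \<Rightarrow> nat \<Rightarrow> nat \<Rightarrow> (nat \<Rightarrow> nat) \<Rightarrow> bool" where
  "marks lv s q mk \<longleftrightarrow>
     (\<forall>j \<in> V. mk j \<noteq> 0 \<longrightarrow> lv j < mk j \<and> mk j \<le> (if q = 0 then s else Suc s)) \<and>
     ((\<exists>t \<in> T. mk t = 1) \<or> (\<forall>t \<in> T. lv t \<noteq> 0) \<and> (\<forall>j \<in> V. mk j = 0)) \<and>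
     card (marked mk s) \<le> (f + 1) ^ (s - 1) \<and>
     card {j \<in> V. mk j = Suc s} \<le> card {d \<in> set (take q fs). snd d \<in> marked mk s} \<and>
     (\<forall>LS i. (LS, i) \<in> F \<longrightarrow> (\<forall>s'. s' < s \<longrightarrow> 0 < mk i \<longrightarrow> mk i \<le> s' \<longrightarrow> (\<exists>j \<in> LS. 0 < mk j \<and> mk j \<le> Suc s'))) \<and>
     (\<forall>LS i. (LS, i) \<in> set (take q fs) \<longrightarrow> 0 < mk i \<longrightarrow> mk i \<le> s \<longrightarrow> (\<exists>j \<in> LS. 0 < mk j \<and> mk j \<le> Suc s))"

lemma marksD:
  assumes "marks lv s q mk"
  shows "j \<in> V \<Longrightarrow> mk j \<noteq> 0 \<Longrightarrow> lv j < mk j \<and> mk j \<le> (if q = 0 then s else Suc s)"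
    and "(\<exists>t \<in> T. mk t = 1) \<or> (\<forall>t \<in> T. lv t \<noteq> 0) \<and> (\<forall>j \<in> V. mk j = 0)"
    and "card (marked mk s) \<le> (f + 1) ^ (s - 1)"
    and "card {j \<in> V. mk j = Suc s} \<le> card {d \<in> set (take q fs). snd d \<in> marked mk s}"
    and "(LS, i) \<in> F \<Longrightarrow> s' < s \<Longrightarrow> 0 < mk i \<Longrightarrow> mk i \<le> s' \<Longrightarrow> \<exists>j \<in> LS. 0 < mk j \<and> mk j \<le> Suc s'"
    and "(LS, i) \<in> set (take q fs) \<Longrightarrow> 0 < mk i \<Longrightarrow> mk i \<le> s \<Longrightarrow> \<exists>j \<in> LS. 0 < mk j \<and> mk j \<le> Suc s"
  using assms unfolding marks_def by blast+

text \<open>Here \<open>t\<close> is the outcome of the scan over the targets. Since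
  \<open>0\<close> is not an attribute, \<open>t = 0\<close> signals that every target is inferred,
  and then nothing is marked.\<close>

lemma marks_init:
  assumes "t = 0 \<and> (\<forall>j \<in> T. lv j \<noteq> 0) \<or> t \<in> T \<and> lv t = 0"
    and "\<forall>j \<in> V. mk j = (if j = t then 1 else 0)"
  shows "marks lv 1 0 mk"
proof -
  have "marked mk 1 \<subseteq> {t}"
    using assms(2) by (auto simp: marked_def split: if_splits)
  then have "card (marked mk 1) \<le> 1"
    using card_mono[of "{t}"] by fastforce
  moreover have "{j \<in> V. mk j = Suc 1} = {}"
    using assms(2) by auto
  moreover have "(\<exists>t \<in> T. mk t = 1) \<or> (\<forall>t \<in> T. lv t \<noteq> 0) \<and> (\<forall>j \<in> V. mk j = 0)"
  proof (cases "t = 0")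
    case True
    then have "\<forall>j \<in> T. lv j \<noteq> 0"
      using assms(1) T_subset by auto
    moreover have "\<forall>j \<in> V. mk j = 0"
      using assms(2) True by simp
    ultimately show ?thesis by blast
  next
    case False
    then show ?thesis using assms T_subset by (intro disjI1 bexI[of _ t]) auto
  qed
  moreover have "lv j < mk j \<and> mk j \<le> 1" if "j \<in> V" "mk j \<noteq> 0" for j
  proof -
    have "j = t" using assms(2) that by metis
    then show ?thesis using assms that by auto
  qed
  ultimately show ?thesis
    unfolding marks_def using assms(2) by auto
qed

text \<open>A conclusion marked at most \<open>s\<close> has level below \<open>s\<close>. As the
  levels are closed at threshold \<open>s\<close>, some premise has level at most \<open>s\<close>,
  so the scan cannot have failed and \<open>v\<close> is such a premise. If \<open>v\<close> already
  carries a mark, that mark is at most \<open>Suc s\<close> and suffices; otherwise \<open>v\<close>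
  gets \<open>Suc s\<close>, charged to the current dependency.\<close>

lemma marks_step:
  assumes lv: "levels X 0 0 lv" and mk: "marks lv s q mk"
    and q: "q < m" "fs ! q = (LS, i)" and s: "1 \<le> s" "s \<le> D"
    and v: "v = 0 \<and> (\<forall>j \<in> LS. s < lv j) \<or> v \<in> LS \<and> lv v \<le> s"
  shows "mk i \<noteq> 0 \<and> mk i \<le> s \<Longrightarrow> v \<in> LS"
    and "marks lv s (Suc q) (if mk i \<noteq> 0 \<and> mk i \<le> s \<and> mk v = 0 then mk(v := Suc s) else mk)"
proof -
  have fd: "(LS, i) \<in> F" using q by (metis nth_mem)
  have fdV: "LS \<subseteq> V" "i \<in> V" using fdD[OF fd] by auto
  have take: "set (take (Suc q) fs) = insert (LS, i) (set (take q fs))"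
    using q by (simp add: take_Suc_conv_app_nth)
  \<comment> \<open>Distinctness of \<open>fs\<close> makes the dependency paying for the new mark
    different from all those already counted.\<close>
  have new: "(LS, i) \<notin> set (take q fs)"
    using distinct_take[OF dist, of "Suc q"] q by (simp add: take_Suc_conv_app_nth)
  have vLS: "v \<in> LS" if "mk i \<noteq> 0" "mk i \<le> s"
  proof -
    have "lv i < s"
      using marksD(1)[OF mk fdV(2)] that by simp
    then have "\<not> (\<forall>j \<in> LS. s < lv j)"
      using levelsD(3)[OF lv fd, of s] s by auto
    then show ?thesis using v by auto
  qed
  then show "mk i \<noteq> 0 \<and> mk i \<le> s \<Longrightarrow> v \<in> LS" by simp
  show "marks lv s (Suc q) (if mk i \<noteq> 0 \<and> mk i \<le> s \<and> mk v = 0 then mk(v := Suc s) else mk)"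
  proof (cases "mk i \<noteq> 0 \<and> mk i \<le> s \<and> mk v = 0")
    case True
    define mk' where "mk' = mk(v := Suc s)"
    have v: "v \<in> LS" "v \<in> V" "lv v \<le> s" using vLS True v fdV by auto
    \<comment> \<open>The mark \<open>Suc s\<close> replaces a \<open>0\<close>, so it is invisible
      at all thresholds up to \<open>s\<close>.\<close>
    have low: "0 < mk' j \<and> mk' j \<le> s' \<longleftrightarrow> 0 < mk j \<and> mk j \<le> s'" if "s' \<le> s" for j s'
      using that True by (auto simp: mk'_def)
    have high: "0 < mk' j \<and> mk' j \<le> Suc s'" if "0 < mk j \<and> mk j \<le> Suc s'" for j s'
      using that True by (auto simp: mk'_def)
    have marked: "marked mk' s = marked mk s"
      unfolding marked_def using low by blast
    have "marks lv s (Suc q) mk'"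
      unfolding marks_def take marked
    proof (intro conjI)
      show "\<forall>j \<in> V. mk' j \<noteq> 0 \<longrightarrow> lv j < mk' j \<and> mk' j \<le> (if Suc q = 0 then s else Suc s)"
      proof (intro ballI impI)
        fix j assume "j \<in> V" "mk' j \<noteq> 0"
        then show "lv j < mk' j \<and> mk' j \<le> (if Suc q = 0 then s else Suc s)"
          using marksD(1)[OF mk, of j] v by (cases "j = v") (auto split: if_splits simp: mk'_def)
      qed
      show "(\<exists>t \<in> T. mk' t = 1) \<or> (\<forall>t \<in> T. lv t \<noteq> 0) \<and> (\<forall>j \<in> V. mk' j = 0)"
        using marksD(2)[OF mk] True fdV unfolding mk'_def by (metis fun_upd_apply zero_neq_one)
      show "card (marked mk s) \<le> (f + 1) ^ (s - 1)"
        by (fact marksD(3)[OF mk])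
      have "{j \<in> V. mk' j = Suc s} = insert v {j \<in> V. mk j = Suc s}"
        using v by (auto simp: mk'_def)
      then have "card {j \<in> V. mk' j = Suc s} = Suc (card {j \<in> V. mk j = Suc s})"
        using True by simp
      also have "\<dots> \<le> Suc (card {d \<in> set (take q fs). snd d \<in> marked mk s})"
        using marksD(4)[OF mk] by simp
      also have "\<dots> = card (insert (LS, i) {d \<in> set (take q fs). snd d \<in> marked mk s})"
        using new by simp
      also have "insert (LS, i) {d \<in> set (take q fs). snd d \<in> marked mk s} =
          {d \<in> insert (LS, i) (set (take q fs)). snd d \<in> marked mk s}"
        using True fdV by (auto simp: marked_def)
      finally show "card {j \<in> V. mk' j = Suc s} \<le>
          card {d \<in> insert (LS, i) (set (take q fs)). snd d \<in> marked mk s}" .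
      show "\<forall>LS i. (LS, i) \<in> F \<longrightarrow> (\<forall>s'. s' < s \<longrightarrow> 0 < mk' i \<longrightarrow> mk' i \<le> s' \<longrightarrow>
          (\<exists>j \<in> LS. 0 < mk' j \<and> mk' j \<le> Suc s'))"
        using marksD(5)[OF mk] low high by (meson less_imp_le)
      show "\<forall>LS' i'. (LS', i') \<in> insert (LS, i) (set (take q fs)) \<longrightarrow> 0 < mk' i' \<longrightarrow>
          mk' i' \<le> s \<longrightarrow> (\<exists>j \<in> LS'. 0 < mk' j \<and> mk' j \<le> Suc s)"
      proof (intro allI impI)
        fix LS' i'
        assume *: "(LS', i') \<in> insert (LS, i) (set (take q fs))" "0 < mk' i'" "mk' i' \<le> s"
        show "\<exists>j \<in> LS'. 0 < mk' j \<and> mk' j \<le> Suc s"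
        proof (cases "(LS', i') = (LS, i)")
          case True
          then show ?thesis using v(1) by (auto simp: mk'_def)
        next
          case False
          then have "(LS', i') \<in> set (take q fs)" "0 < mk i'" "mk i' \<le> s"
            using * low[OF order_refl, of i'] by auto
          then obtain j where "j \<in> LS'" "0 < mk j \<and> mk j \<le> Suc s"
            using marksD(6)[OF mk] by blast
          then show ?thesis using high by blast
        qed
      qed
    qed
    then show ?thesis using True by (simp add: mk'_def)
  next
    case False
    have "\<exists>j \<in> LS. 0 < mk j \<and> mk j \<le> Suc s" if "0 < mk i" "mk i \<le> s"
    proof -
      have "v \<in> LS" "mk v \<noteq> 0" using vLS that False by auto
      moreover have "mk v \<le> Suc s"
        using marksD(1)[OF mk, of v] \<open>v \<in> LS\<close> \<open>mk v \<noteq> 0\<close> fdV by (auto split: if_splits)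
      ultimately show ?thesis by auto
    qed
    moreover have "mk j \<le> Suc s" if "j \<in> V" "mk j \<noteq> 0" for j
      using marksD(1)[OF mk that] by (auto split: if_splits)
    moreover have "card {d \<in> set (take q fs). snd d \<in> marked mk s} \<le>
        card {d \<in> insert (LS, i) (set (take q fs)). snd d \<in> marked mk s}"
      by (intro card_mono) auto
    ultimately have "marks lv s (Suc q) mk"
      using mk unfolding marks_def take by simp
    then show ?thesis unfolding if_not_P[OF False] .
  qed
qed

text \<open>Grouped by right-hand side, the dependencies contribute at most \<open>f\<close> to each
  member of \<open>C\<close>.\<close>

lemma card_fds:
  assumes "C \<subseteq> V"
  shows "card {d \<in> F. snd d \<in> C} \<le> f * card C"
proof -
  have fin: "finite C" using assms finite_subset by blast
  have "{d \<in> F. snd d \<in> C} \<subseteq> (\<Union>i \<in> C. (\<lambda>X. (X, i)) ` {X. X \<subseteq> V \<and> (X, i) \<in> F})"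
    using fdD by force
  moreover have fin': "finite {X. X \<subseteq> V \<and> (X, i) \<in> F}" for i
    by (rule finite_subset[of _ "Pow V"]) auto
  ultimately have "card {d \<in> F. snd d \<in> C} \<le>
      card (\<Union>i \<in> C. (\<lambda>X. (X, i)) ` {X. X \<subseteq> V \<and> (X, i) \<in> F})"
    using fin by (intro card_mono) auto
  also have "\<dots> \<le> (\<Sum>i \<in> C. card ((\<lambda>X. (X, i)) ` {X. X \<subseteq> V \<and> (X, i) \<in> F}))"
    using fin by (rule card_UN_le)
  also have "\<dots> \<le> (\<Sum>i \<in> C. f)"
  proof (rule sum_mono)
    fix i assume "i \<in> C"
    then have "card {X. X \<subseteq> V \<and> (X, i) \<in> F} \<le> f"
      unfolding f_def max_fds_def using assms by (intro Max_ge) auto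
    then show "card ((\<lambda>X. (X, i)) ` {X. X \<subseteq> V \<and> (X, i) \<in> F}) \<le> f"
      using card_image_le[OF fin'] order_trans by blast
  qed
  finally show ?thesis by (simp add: mult.commute)
qed

text \<open>Each round adds at most \<open>f\<close> new marks per attribute marked so far, so the
  marked set grows by a factor of at most \<open>f + 1\<close>.\<close>

lemma marks_next:
  assumes mk: "marks lv s m mk" and s: "1 \<le> s"
  shows "marks lv (Suc s) 0 mk"
proof -
  have low: "mk j \<le> Suc s" if "j \<in> V" for j
    using marksD(1)[OF mk that] by (cases "mk j = 0") (auto split: if_splits)
  have "card (marked mk (Suc s)) \<le> card (marked mk s) + card {j \<in> V. mk j = Suc s}"
  proof -
    have "marked mk (Suc s) \<subseteq> marked mk s \<union> {j \<in> V. mk j = Suc s}"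
      by (auto simp: marked_def)
    then have "card (marked mk (Suc s)) \<le> card (marked mk s \<union> {j \<in> V. mk j = Suc s})"
      by (intro card_mono) (auto simp: marked_def)
    then show ?thesis using card_Un_le order_trans by blast
  qed
  also have "\<dots> \<le> card (marked mk s) + f * card (marked mk s)"
  proof -
    have "card {j \<in> V. mk j = Suc s} \<le> card {d \<in> F. snd d \<in> marked mk s}"
      using marksD(4)[OF mk] by simp
    also have "\<dots> \<le> f * card (marked mk s)"
      by (rule card_fds) (auto simp: marked_def)
    finally show ?thesis by simp
  qed
  also have "\<dots> \<le> (f + 1) * (f + 1) ^ (s - 1)"
    using mult_left_mono[OF marksD(3)[OF mk], of "f + 1"] by (simp add: algebra_simps)
  also have "\<dots> = (f + 1) ^ (Suc s - 1)"
    using s by (cases s) auto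
  finally have card: "card (marked mk (Suc s)) \<le> (f + 1) ^ (Suc s - 1)" .
  have none: "{j \<in> V. mk j = Suc (Suc s)} = {}"
    using low by fastforce
  show ?thesis
    unfolding marks_def
  proof (intro conjI)
    show "\<forall>j \<in> V. mk j \<noteq> 0 \<longrightarrow> lv j < mk j \<and> mk j \<le> (if 0 = (0::nat) then Suc s else Suc (Suc s))"
      using marksD(1)[OF mk] low by simp
    show "(\<exists>t \<in> T. mk t = 1) \<or> (\<forall>t \<in> T. lv t \<noteq> 0) \<and> (\<forall>j \<in> V. mk j = 0)"
      by (fact marksD(2)[OF mk])
    show "card (marked mk (Suc s)) \<le> (f + 1) ^ (Suc s - 1)"
      by (fact card)
    have "\<exists>j \<in> LS. 0 < mk j \<and> mk j \<le> Suc s'"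
      if "(LS, i) \<in> F" "s' < Suc s" "0 < mk i" "mk i \<le> s'" for LS i s'
    proof (cases "s' = s")
      case True
      then show ?thesis using marksD(6)[OF mk, of LS i] that by simp
    next
      case False
      then have "s' < s" using that by simp
      then show ?thesis using marksD(5)[OF mk] that by blast
    qed
    then show "\<forall>LS i. (LS, i) \<in> F \<longrightarrow> (\<forall>s'. s' < Suc s \<longrightarrow> 0 < mk i \<longrightarrow> mk i \<le> s' \<longrightarrow>
        (\<exists>j \<in> LS. 0 < mk j \<and> mk j \<le> Suc s'))"
      by blast
  qed (use none in simp_all)
qed

lemma marks_result:
  assumes lv: "levels X 0 0 lv" and mk: "marks lv (Suc D) 0 mk" and X: "X \<subseteq> V"
  defines "C \<equiv> {j \<in> V. mk j \<noteq> 0}"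
  shows "C \<inter> X = {}" "card C \<le> (f + 1) ^ D"
    and "C = {} \<Longrightarrow> feasible D n F T X"
    and "C \<noteq> {} \<Longrightarrow> feasible D n F T Z \<Longrightarrow> Z \<inter> C \<noteq> {}"
proof -
  have bound: "lv j < mk j \<and> mk j \<le> Suc D" if "j \<in> C" for j
    using marksD(1)[OF mk, of j] that unfolding C_def by auto
  \<comment> \<open>Members of \<open>X\<close> have level \<open>Suc D\<close>, whereas on
    \<open>C\<close> the level is strictly below a mark of at most \<open>Suc D\<close>.\<close>
  show "C \<inter> X = {}"
    using bound levelsD(2)[OF lv] unfolding C_def by fastforce
  have C: "C = marked mk (Suc D)"
    using bound by (auto simp: marked_def C_def)
  then show "card C \<le> (f + 1) ^ D"
    using mk by (simp add: marks_def)
  show "feasible D n F T X" if "C = {}"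
  proof -
    have "\<forall>t \<in> T. lv t \<noteq> 0"
      using marksD(2)[OF mk] that T_subset unfolding C_def by fastforce
    then have "t \<in> infer F X D" if "t \<in> T" for t
      using levelsD(1)[OF lv, of t] that T_subset infer_mono[of "Suc D - lv t" D F X] by fastforce
    then show ?thesis using X by (auto simp: feasible_def)
  qed
  show "Z \<inter> C \<noteq> {}" if "C \<noteq> {}" and Z: "feasible D n F T Z"
  proof
    assume disj: "Z \<inter> C = {}"
    \<comment> \<open>The threshold falls as \<open>k\<close> rises: a conclusion with a small mark
      has a premise whose mark is larger by at most one, and that premise would have to be inferred
      one round earlier.\<close>
    have "infer F Z k \<inter> marked mk (Suc D - k) = {}" if "k \<le> D" for k
      using that
    proof (induction k)
      case 0
      then show ?case using disj C by simp
    next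
      case (Suc k)
      show ?case
      proof (rule ccontr)
        assume "infer F Z (Suc k) \<inter> marked mk (Suc D - Suc k) \<noteq> {}"
        then obtain i where i: "i \<in> infer F Z (Suc k)" "i \<in> marked mk (D - k)" by auto
        \<comment> \<open>The marked sets increase with the threshold, so the induction hypothesis
          excludes \<open>i\<close> from the first \<open>k\<close> rounds; only a dependency can
          have produced it.\<close>
        then have "i \<notin> infer F Z k"
          using Suc by (auto simp: marked_def)
        then obtain LS where LS: "(LS, i) \<in> F" "LS \<subseteq> infer F Z k"
          using i by auto
        have "D - k < Suc D" "0 < mk i" "mk i \<le> D - k"
          using i by (auto simp: marked_def)
        then have "\<exists>j \<in> LS. 0 < mk j \<and> mk j \<le> Suc (D - k)"
          using marksD(5)[OF mk LS(1)] by blast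
        then obtain j where j: "j \<in> LS" "0 < mk j" "mk j \<le> Suc D - k"
          using Suc.prems by (auto simp: Suc_diff_le)
        then have "j \<in> marked mk (Suc D - k)"
          using fdD[OF LS(1)] by (auto simp: marked_def)
        then show False using Suc j(1) LS(2) by auto
      qed
    qed
    \<comment> \<open>At \<open>k = D\<close> only mark \<open>1\<close> is left. Since
      \<open>C\<close> is nonempty, the invariant provides a target with that mark, which
      \<open>Z\<close> would fail to infer.\<close>
    from this[of D] have "infer F Z D \<inter> marked mk 1 = {}" by simp
    moreover have "\<not> (\<forall>j \<in> V. mk j = 0)"
      using that(1) by (auto simp: C_def)
    then obtain t where "t \<in> T" "mk t = 1"
      using marksD(2)[OF mk] by blast
    ultimately show False
      using Z T_subset unfolding feasible_def marked_def by fastforce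
  qed
qed


subsection \<open>Memory layout\<close>

text \<open>Before the output phase the program never writes to the input cells, so
  \<open>lv\<close> and \<open>mk\<close> on \<open>V\<close> describe the whole memory.\<close>

definition mem :: "(nat \<Rightarrow> nat) \<Rightarrow> (nat \<Rightarrow> nat) \<Rightarrow> nat \<Rightarrow> nat" where
  "mem lv mk a =
     (if a \<le> L then snd (init_state w) a
      else if a \<le> L + n then lv (a - L)
      else if a \<le> L + n + n then mk (a - (L + n)) else 0)"

text \<open>The cell just in front of block \<open>q\<close>: the bit of premise \<open>j\<close> is
  at \<open>addr q + j\<close>, and the conclusion sits at \<open>addr (Suc q)\<close>, the base of
  the next block. For \<open>q = 0\<close> this is the cell holding \<open>m\<close>.\<close>

definition addr :: "nat \<Rightarrow> nat" where
  "addr q = n + 3 + q * Suc n"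

lemma addr_Suc: "addr q + Suc n = addr (Suc q)"
  by (simp add: addr_def)

lemma mem_lv [simp]: "1 \<le> j \<Longrightarrow> j \<le> n \<Longrightarrow> mem lv mk (L + j) = lv j"
  and mem_mk [simp]: "1 \<le> j \<Longrightarrow> j \<le> n \<Longrightarrow> mem lv mk (L + n + j) = mk j"
  by (auto simp: mem_def)

text \<open>These rules keep the memory in the form \<open>mem lv mk\<close>, turning a store of the
  program into an update of one array.\<close>

lemma mem_upd_lv [simp]: "1 \<le> j \<Longrightarrow> j \<le> n \<Longrightarrow> (mem lv mk)(L + j := v) = mem (lv(j := v)) mk"
  and mem_upd_mk [simp]: "1 \<le> j \<Longrightarrow> j \<le> n \<Longrightarrow> (mem lv mk)(L + n + j := v) = mem lv (mk(j := v))"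
  by (auto simp: mem_def fun_eq_iff)

lemma length_bits [simp]: "length (bits n X) = n"
  by (simp add: bits_def)

lemma nth_bits: "1 \<le> j \<Longrightarrow> j \<le> n \<Longrightarrow> bits n X ! (j - 1) = (if j \<in> X then 1 else 0)"
  by (simp add: bits_def del: upt_Suc)

definition blocks :: "nat list list" where
  "blocks = map (\<lambda>(LS, i). bits n LS @ [i]) fs"

lemma w_eq: "w = [D, n] @ bits n T @ [m] @ concat blocks"
  by (simp add: w_def encode_def blocks_def)

lemma length_block: "\<forall>b \<in> set blocks. length b = Suc n"
  by (auto simp: blocks_def)

lemma L_eq: "L = n + 3 + m * Suc n"
  using length_concat_uniform[OF length_block] by (simp add: L_def w_eq blocks_def)

text \<open>Every loop counter starts at \<open>n\<close>, \<open>m\<close> or \<open>D\<close>, so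
  \<open>Suc L\<close> is a strict bound for all loops.\<close>

lemma L_bounds: "n < Suc L" "m < Suc L" "D < Suc L"
  using D_bounds by (auto simp: L_eq)

lemma mem_input: "1 \<le> a \<Longrightarrow> a \<le> L \<Longrightarrow> mem lv mk a = w ! (a - 1)"
  by (simp add: mem_def init_state_def L_def)

lemma mem_header: "mem lv mk 0 = L" "mem lv mk 1 = D" "mem lv mk 2 = n" "mem lv mk (n + 3) = m"
proof -
  show "mem lv mk 0 = L"
    by (simp add: mem_def init_state_def L_def)
  show "mem lv mk 1 = D" "mem lv mk 2 = n" "mem lv mk (n + 3) = m"
    by (simp_all add: mem_input L_eq) (simp_all add: w_eq nth_append)
qed

lemma mem_target:
  assumes "1 \<le> j" "j \<le> n"
  shows "mem lv mk (2 + j) = (if j \<in> T then 1 else 0)"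
proof -
  have "mem lv mk (2 + j) = w ! Suc j"
    using assms by (simp add: mem_input L_eq)
  also have "\<dots> = bits n T ! (j - 1)"
    using assms by (cases j) (simp_all add: w_eq nth_append)
  finally show ?thesis using nth_bits[OF assms, of T] by simp
qed

lemma mem_block:
  assumes "q < m" "fs ! q = (LS, i)" "1 \<le> j" "j \<le> Suc n"
  shows "mem lv mk (addr q + j) = (bits n LS @ [i]) ! (j - 1)"
proof -
  have le: "q * Suc n + Suc n \<le> m * Suc n"
    using assms(1) by (metis Suc_leI add.commute mult_Suc mult_le_mono1)
  \<comment> \<open>The header \<open>D\<close>, \<open>n\<close>, target bits, \<open>m\<close> has
    \<open>n + 3\<close> entries; the shift to \<open>j - 1\<close> arises because cells are
    numbered from \<open>1\<close> and list positions from \<open>0\<close>.\<close>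
  have "mem lv mk (addr q + j) = w ! (n + 3 + (q * Suc n + (j - 1)))"
    using le assms(3,4) by (subst mem_input) (auto simp: addr_def L_eq intro: arg_cong[where f = "nth w"])
  also have "\<dots> = concat blocks ! (q * Suc n + (j - 1))"
  proof -
    have "w ! (n + 3 + a) = concat blocks ! a" for a
      by (simp add: w_eq nth_append)
    then show ?thesis .
  qed
  also have "\<dots> = blocks ! q ! (j - 1)"
    using assms length_block by (intro nth_concat_uniform) (auto simp: blocks_def)
  finally show ?thesis
    using assms by (simp add: blocks_def)
qed

lemma mem_premise:
  assumes "q < m" "fs ! q = (LS, i)" "1 \<le> j" "j \<le> n"
  shows "mem lv mk (addr q + j) = (if j \<in> LS then 1 else 0)"
proof -
  have "j - 1 < n" using assms(3,4) by linarith
  then show ?thesis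
    using mem_block[OF assms(1,2), of j] assms(3,4) nth_bits[of j LS] by (simp add: nth_append)
qed

lemma mem_conclusion:
  assumes "q < m" "fs ! q = (LS, i)"
  shows "mem lv mk (addr (Suc q)) = i"
  using mem_block[OF assms, of "Suc n"] by (simp add: nth_append flip: addr_Suc)


subsection \<open>Correctness of the program\<close>

text \<open>Registers above \<open>14\<close> are scratch and left free; results passed in
  \<open>16\<close> and \<open>19\<close> are stated separately.\<close>

definition regs :: "nat \<Rightarrow> nat \<Rightarrow> nat \<Rightarrow> nat \<Rightarrow> nat \<Rightarrow> (nat \<Rightarrow> nat) \<Rightarrow> bool" where
  "regs x y z k p R \<longleftrightarrow>
     R 0 = 0 \<and> R 1 = 1 \<and> R 2 = n \<and> R 3 = D \<and> R 4 = L \<and> R 5 = L + n \<and> R 6 = addr 0 \<and>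
     R 7 = Suc n \<and> R 8 = m \<and> R 9 = Suc D \<and> R 10 = x \<and> R 11 = y \<and> R 12 = z \<and> R 13 = k \<and> R 14 = p"

definition st ::
  "nat \<Rightarrow> nat \<Rightarrow> nat \<Rightarrow> nat \<Rightarrow> nat \<Rightarrow> ((nat \<Rightarrow> nat) \<Rightarrow> (nat \<Rightarrow> nat) \<Rightarrow> bool) \<Rightarrow> state \<Rightarrow> bool" where
  "st x y z k p I s \<longleftrightarrow> regs x y z k p (fst s) \<and> (\<exists>lv mk. snd s = mem lv mk \<and> I lv mk)"

lemma st_mono:
  "st x y z k p I s \<Longrightarrow> (\<And>lv mk. I lv mk \<Longrightarrow> I' lv mk) \<Longrightarrow> st x y z k p I' s"
  unfolding st_def by blast

text \<open>For \<open>A \<subseteq> V\<close> the value \<open>0\<close> is an unambiguous sign of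
  failure.\<close>

definition found :: "nat set \<Rightarrow> (nat \<Rightarrow> nat) \<Rightarrow> nat \<Rightarrow> nat \<Rightarrow> bool" where
  "found A lv y v \<longleftrightarrow> v = 0 \<and> (\<forall>j \<in> A. y < lv j) \<or> v \<in> A \<and> lv v \<le> y"

abbreviation triple :: "(state \<Rightarrow> bool) \<Rightarrow> com \<Rightarrow> (state \<Rightarrow> bool) \<Rightarrow> bool" where
  "triple \<equiv> hoare (Suc L)"

section \<open>Scanning a set and looping over the dependencies\<close>

lemma scan_correct:
  assumes A: "A \<subseteq> V" and bits: "\<And>j. 1 \<le> j \<Longrightarrow> j \<le> n \<Longrightarrow> mem lv mk (p + j) = (if j \<in> A then 1 else 0)"
  shows "triple (\<lambda>(R, M). regs x y z k p R \<and> M = mem lv mk) scan_prog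
    (\<lambda>(R, M). regs x y z k p R \<and> M = mem lv mk \<and> found A lv y (R 16))"
proof -
  \<comment> \<open>Entries above \<open>j\<close> have been visited. A later hit overwrites an
    earlier one, as any witness will do.\<close>
  define I where "I j = (\<lambda>(R, M). regs x y z k p R \<and> M = mem lv mk \<and> R 15 = j \<and> j \<le> n \<and>
    (R 16 = 0 \<and> (\<forall>i \<in> A. j < i \<longrightarrow> y < lv i) \<or> R 16 \<in> A \<and> lv (R 16) \<le> y))" for j
  have "triple (I n) (While 15 scan_body) (I 0)"
  proof (rule hoare_While)
    show "triple (I (Suc j)) scan_body (I j)" if "Suc j \<le> n" for j
    proof (rule hoare_run)
      show "loop_free scan_body" by (simp add: scan_body_def)
      fix R M assume "I (Suc j) (R, M)"
      then have R: "regs x y z k p R" "M = mem lv mk" "R 15 = Suc j" "Suc j \<le> n"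
        "R 16 = 0 \<and> (\<forall>i \<in> A. Suc j < i \<longrightarrow> y < lv i) \<or> R 16 \<in> A \<and> lv (R 16) \<le> y"
        by (auto simp: I_def)
      have lv: "mem lv mk (L + Suc j) = lv (Suc j)" using R(4) by (intro mem_lv) auto
      have bit: "mem lv mk (p + Suc j) = (if Suc j \<in> A then 1 else 0)" using R(4) by (intro bits) auto
      have less: "j < i \<longleftrightarrow> i = Suc j \<or> Suc j < i" for i by auto
      show "I j (run scan_body (R, M))"
        using R lv bit unfolding I_def scan_body_def regs_def less by auto
    qed
  qed (use L_bounds in \<open>auto simp: I_def\<close>)
  moreover have "triple (\<lambda>(R, M). regs x y z k p R \<and> M = mem lv mk) (seq [Const 16 0, Add 15 2 0]) (I n)"
    using A by (intro hoare_run) (fastforce simp: I_def regs_def)+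
  ultimately show ?thesis
    unfolding scan_prog_def using A
    by (intro hoare_conseq[OF hoare_Seq]) (fastforce simp: I_def found_def)+
qed

text \<open>A common rule for inference and marking. \<open>I q\<close> speaks of the first
  \<open>q\<close> dependencies, and \<open>c\<close> runs after the pointer has advanced to the
  cell of the conclusion, already loaded into register \<open>19\<close>.\<close>

lemma fds_correct:
  assumes c: "loop_free c"
    and step: "\<And>q LS i lv mk R. q < m \<Longrightarrow> fs ! q = (LS, i) \<Longrightarrow> I q lv mk \<Longrightarrow>
      regs x y z (m - q) (addr (Suc q)) R \<Longrightarrow> found LS lv y (R 16) \<Longrightarrow> R 19 = i \<Longrightarrow>
      st x y z (m - q) (addr (Suc q)) (I (Suc q)) (run c (R, mem lv mk))"
  shows "triple (\<lambda>s. \<exists>k p. st x y z k p (I 0) s) (fds_prog c) (st x y z 0 (addr m) (I m))"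
proof -
  define J where "J k s \<longleftrightarrow> k \<le> m \<and> st x y z k (addr (m - k)) (I (m - k)) s" for k s
  let ?body = "Seq scan_prog (Seq (seq [Add 14 14 7, Load 19 14]) (Seq c (Sub 13 13 1)))"
  have "triple (J m) (While 13 ?body) (J 0)"
  proof (rule hoare_While)
    fix k assume k: "Suc k \<le> m"
    define q where "q = m - Suc k"
    have q: "q < m" "m - k = Suc q" "m - q = Suc k" using k by (auto simp: q_def)
    obtain LS i where fd: "fs ! q = (LS, i)" by fastforce
    have LS: "LS \<subseteq> V" using fd q(1) fdD by (metis nth_mem)
    show "triple (J (Suc k)) ?body (J k)"
    proof (rule hoare_cases)
      fix R M assume "J (Suc k) (R, M)"
      then obtain lv mk where s: "regs x y z (Suc k) (addr q) R" "M = mem lv mk" "I q lv mk"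
        by (auto simp: J_def st_def q_def)
      have "triple (\<lambda>(R, M). regs x y z (Suc k) (addr q) R \<and> M = mem lv mk) ?body (J k)"
      proof (rule hoare_Seq, rule scan_correct[OF LS])
        show "mem lv mk (addr q + j) = (if j \<in> LS then 1 else 0)" if "1 \<le> j" "j \<le> n" for j
          using mem_premise[OF q(1) fd that] .
        show "triple (\<lambda>(R, M). regs x y z (Suc k) (addr q) R \<and> M = mem lv mk \<and> found LS lv y (R 16))
          (Seq (seq [Add 14 14 7, Load 19 14]) (Seq c (Sub 13 13 1))) (J k)"
        proof (rule hoare_run)
          fix R M assume R: "case (R, M) of (R, M) \<Rightarrow>
            regs x y z (Suc k) (addr q) R \<and> M = mem lv mk \<and> found LS lv y (R 16)"
          define R1 where "R1 = R(14 := addr (Suc q), 19 := i)"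
          have "st x y z (Suc k) (addr (Suc q)) (I (Suc q)) (run c (R1, mem lv mk))"
            using step[OF q(1) fd s(3), of R1] R by (simp add: R1_def regs_def q(3))
          moreover have "run (seq [Add 14 14 7, Load 19 14]) (R, M) = (R1, mem lv mk)"
            using R mem_conclusion[OF q(1) fd]
            by (simp add: R1_def regs_def flip: addr_Suc)
          moreover obtain R2 M2 where R2: "run c (R1, mem lv mk) = (R2, M2)" by fastforce
          ultimately have "regs x y z (Suc k) (addr (Suc q)) R2" "\<exists>lv mk. M2 = mem lv mk \<and> I (Suc q) lv mk"
            and run: "run (Seq (seq [Add 14 14 7, Load 19 14]) (Seq c (Sub 13 13 1))) (R, M) =
              run (Sub 13 13 1) (R2, M2)"
            by (simp_all only: st_def run.simps fst_conv snd_conv)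
          then show "J k (run (Seq (seq [Add 14 14 7, Load 19 14]) (Seq c (Sub 13 13 1))) (R, M))"
            unfolding run J_def st_def q(2) using k by (simp add: regs_def)
        qed (simp add: c)
      qed
      then show "\<exists>P. P (R, M) \<and> triple P ?body (J k)"
        using s by (intro exI conjI) auto
    qed
  qed (use L_bounds in \<open>auto simp: J_def st_def regs_def\<close>)
  note loop = this
  have "triple (\<lambda>s. \<exists>k p. st x y z k p (I 0) s) (seq [Add 13 8 0, Add 14 6 0]) (J m)"
    by (intro hoare_run) (auto simp: J_def st_def regs_def)
  from hoare_Seq[OF this loop] show ?thesis
    unfolding fds_prog_def by (rule hoare_conseq) (auto simp: J_def)
qed

section \<open>The phases of one repetition\<close>

lemma infer_step_correct:
  assumes r: "1 \<le> r" "r \<le> D"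
  shows "triple (\<lambda>s. \<exists>k p. st x r z k p (\<lambda>lv mk. levels X r 0 lv \<and> (\<forall>j \<in> V. mk j = 0)) s)
    (fds_prog infer_step) (st x r z 0 (addr m) (\<lambda>lv mk. levels X r m lv \<and> (\<forall>j \<in> V. mk j = 0)))"
proof (rule fds_correct)
  fix q LS i R and lv mk :: "nat \<Rightarrow> nat"
  assume q: "q < m" "fs ! q = (LS, i)" and I: "levels X r q lv \<and> (\<forall>j \<in> V. mk j = 0)"
    and R: "regs x r z (m - q) (addr (Suc q)) R" "found LS lv r (R 16)" "R 19 = i"
  have fd: "(LS, i) \<in> F" using q by (metis nth_mem)
  note i = fdD[OF fd]
  have "R 16 = 0 \<longleftrightarrow> (\<forall>j \<in> LS. r < lv j)"
    using R(2) i by (fastforce simp: found_def)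
  then have "regs x r z (m - q) (addr (Suc q)) (fst (run infer_step (R, mem lv mk)))"
    "snd (run infer_step (R, mem lv mk)) =
      mem (if lv i = 0 \<and> (\<forall>j \<in> LS. r < lv j) then lv(i := r) else lv) mk"
    using R(1,3) i by (simp_all add: infer_step_def regs_def)
  then show "st x r z (m - q) (addr (Suc q)) (\<lambda>lv mk. levels X r (Suc q) lv \<and> (\<forall>j \<in> V. mk j = 0))
      (run infer_step (R, mem lv mk))"
    using levels_step[OF conjunct1[OF I] q r] I unfolding st_def by blast
qed (simp add: infer_step_def)

text \<open>Register \<open>11\<close> is both loop counter and threshold: value \<open>r\<close>
  belongs to inference round \<open>D + 1 - r\<close>. The marks stay zero for the marking
  phase.\<close>

lemma infer_correct:
  "triple (\<lambda>s. \<exists>y z k p. st x y z k p (\<lambda>lv mk. levels X D 0 lv \<and> (\<forall>j \<in> V. mk j = 0)) s) infer_prog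
    (\<lambda>s. \<exists>y z k p. st x y z k p (\<lambda>lv mk. levels X 0 0 lv \<and> (\<forall>j \<in> V. mk j = 0)) s)"
proof -
  define J where "J r s \<longleftrightarrow>
    (\<exists>z k p. st x r z k p (\<lambda>lv mk. levels X r 0 lv \<and> (\<forall>j \<in> V. mk j = 0)) s)" for r s
  have "triple (J D) (While 11 (Seq (fds_prog infer_step) (Sub 11 11 1))) (J 0)"
  proof (rule hoare_While)
    fix r assume r: "Suc r \<le> D"
    show "triple (J (Suc r)) (Seq (fds_prog infer_step) (Sub 11 11 1)) (J r)"
    proof (rule hoare_cases)
      fix R M assume "J (Suc r) (R, M)"
      then obtain z where z:
        "\<exists>k p. st x (Suc r) z k p (\<lambda>lv mk. levels X (Suc r) 0 lv \<and> (\<forall>j \<in> V. mk j = 0)) (R, M)"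
        unfolding J_def by blast
      let ?B = "st x (Suc r) z 0 (addr m) (\<lambda>lv mk. levels X (Suc r) m lv \<and> (\<forall>j \<in> V. mk j = 0))"
      have "triple ?B (Sub 11 11 1) (J r)"
      proof (rule hoare_run)
        fix R M assume "?B (R, M)"
        then have "st x (Suc r) z 0 (addr m) (\<lambda>lv mk. levels X r 0 lv \<and> (\<forall>j \<in> V. mk j = 0)) (R, M)"
          by (rule st_mono) (simp add: levels_next)
        then show "J r (run (Sub 11 11 1) (R, M))"
          by (auto simp: J_def st_def regs_def)
      qed simp
      from hoare_Seq[OF infer_step_correct this] r
      have "triple (\<lambda>s. \<exists>k p. st x (Suc r) z k p (\<lambda>lv mk. levels X (Suc r) 0 lv \<and> (\<forall>j \<in> V. mk j = 0)) s)
          (Seq (fds_prog infer_step) (Sub 11 11 1)) (J r)"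
        by simp
      with z show "\<exists>P. P (R, M) \<and> triple P (Seq (fds_prog infer_step) (Sub 11 11 1)) (J r)"
        by (intro exI conjI)
    qed
  qed (use L_bounds in \<open>auto simp: J_def st_def regs_def\<close>)
  note loop = this
  have "triple (\<lambda>s. \<exists>y z k p. st x y z k p (\<lambda>lv mk. levels X D 0 lv \<and> (\<forall>j \<in> V. mk j = 0)) s)
      (Add 11 3 0) (J D)"
    by (rule hoare_run) (auto simp: J_def st_def regs_def)
  from hoare_Seq[OF this loop] show ?thesis
    unfolding infer_prog_def by (rule hoare_conseq) (auto simp: J_def)
qed

lemma target_correct:
  "triple (\<lambda>s. \<exists>y z k p. st x y z k p (\<lambda>lv mk. levels X 0 0 lv \<and> (\<forall>j \<in> V. mk j = 0)) s) target_prog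
    (\<lambda>s. \<exists>y z k p. st x y z k p (\<lambda>lv mk. levels X 0 0 lv \<and> marks lv 1 0 mk) s)"
    (is "triple ?P _ ?Q")
proof (rule hoare_cases)
  fix R M assume "?P (R, M)"
  then obtain y z k p lv mk where s: "regs x y z k p R" "M = mem lv mk" "levels X 0 0 lv"
    "\<forall>j \<in> V. mk j = 0"
    by (auto simp: st_def)
  let ?body = "If 16 (seq [Add 17 5 16, Store 17 1]) Skip"
  have 1: "triple (\<lambda>(R, M). regs x y z k p R \<and> M = mem lv mk) (seq [Const 14 2, Const 11 0])
      (\<lambda>(R, M). regs x 0 z k 2 R \<and> M = mem lv mk)"
    by (rule hoare_run) (auto simp: regs_def)
  \<comment> \<open>Threshold \<open>0\<close> selects the attributes without a level, those not
    inferred within \<open>D\<close> rounds; base \<open>2\<close> is where the target bits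
    start.\<close>
  have 2: "triple (\<lambda>(R, M). regs x 0 z k 2 R \<and> M = mem lv mk) scan_prog
      (\<lambda>(R, M). regs x 0 z k 2 R \<and> M = mem lv mk \<and> found T lv 0 (R 16))"
    by (rule scan_correct[OF T_subset mem_target])
  have 3: "triple (\<lambda>(R, M). regs x 0 z k 2 R \<and> M = mem lv mk \<and> found T lv 0 (R 16)) ?body ?Q"
  proof (rule hoare_run)
    fix R M assume "case (R, M) of (R, M) \<Rightarrow> regs x 0 z k 2 R \<and> M = mem lv mk \<and> found T lv 0 (R 16)"
    then have R: "regs x 0 z k 2 R" "M = mem lv mk" "found T lv 0 (R 16)" by auto
    define mk' where "mk' = (if R 16 = 0 then mk else mk(R 16 := 1))"
    have mk': "marks lv 1 0 mk'"
      by (rule marks_init[of "R 16"]) (use R(3) s(4) in \<open>auto simp: found_def mk'_def\<close>)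
    have v: "R 16 \<noteq> 0 \<Longrightarrow> 1 \<le> R 16 \<and> R 16 \<le> n"
      using R(3) T_subset by (auto simp: found_def)
    have "regs x 0 z k 2 (fst (run ?body (R, M)))"
      using R(1) by (simp add: regs_def)
    moreover have "snd (run ?body (R, M)) = mem lv mk'"
      using R(1,2) v by (simp add: regs_def mk'_def)
    ultimately show "?Q (run ?body (R, M))"
      using s(3) mk' unfolding st_def by blast
  qed simp
  have "triple (\<lambda>(R, M). regs x y z k p R \<and> M = mem lv mk) target_prog ?Q"
    unfolding target_prog_def by (rule hoare_Seq[OF 1 hoare_Seq[OF 2 3]])
  then show "\<exists>P. P (R, M) \<and> triple P target_prog ?Q"
    using s by (intro exI conjI) auto
qed

lemma mark_step_correct:
  assumes s: "1 \<le> s" "s \<le> D"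
  shows "triple (\<lambda>t. \<exists>k p. st x s z k p (\<lambda>lv mk. levels X 0 0 lv \<and> marks lv s 0 mk) t)
    (fds_prog mark_step) (st x s z 0 (addr m) (\<lambda>lv mk. levels X 0 0 lv \<and> marks lv s m mk))"
proof (rule fds_correct)
  fix q LS i R and lv mk :: "nat \<Rightarrow> nat"
  assume q: "q < m" "fs ! q = (LS, i)" and I: "levels X 0 0 lv \<and> marks lv s q mk"
    and R: "regs x s z (m - q) (addr (Suc q)) R" "found LS lv s (R 16)" "R 19 = i"
  have fd: "(LS, i) \<in> F" using q by (metis nth_mem)
  note i = fdD[OF fd]
  note step = marks_step[OF conjunct1[OF I] conjunct2[OF I] q s, of "R 16"]
  have v: "mk i \<noteq> 0 \<and> mk i \<le> s \<Longrightarrow> 1 \<le> R 16 \<and> R 16 \<le> n"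
    using step(1) R(2) i by (fastforce simp: found_def)
  have mk: "marks lv s (Suc q) (if mk i \<noteq> 0 \<and> mk i \<le> s \<and> mk (R 16) = 0 then mk(R 16 := Suc s) else mk)"
    using step(2) R(2) by (simp add: found_def)
  show "st x s z (m - q) (addr (Suc q)) (\<lambda>lv mk. levels X 0 0 lv \<and> marks lv s (Suc q) mk)
      (run mark_step (R, mem lv mk))"
  proof (cases "mk i \<noteq> 0 \<and> mk i \<le> s")
    case True
    then show ?thesis
      using mk v R(1,3) i I by (cases "mk (R 16) = 0") (auto simp: mark_step_def st_def regs_def)
  next
    case False
    then have "marks lv s (Suc q) mk" using mk by (simp split: if_splits)
    then show ?thesis
      using False R(1,3) i I by (cases "mk i = 0") (auto simp: mark_step_def st_def regs_def)
  qed
qed (simp add: mark_step_def)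

lemma mark_correct:
  "triple (\<lambda>s. \<exists>y z k p. st x y z k p (\<lambda>lv mk. levels X 0 0 lv \<and> marks lv 1 0 mk) s) mark_prog
    (\<lambda>s. \<exists>y z k p. st x y z k p (\<lambda>lv mk. levels X 0 0 lv \<and> marks lv (Suc D) 0 mk) s)"
proof -
  \<comment> \<open>The counter \<open>z\<close> falls from \<open>D\<close> to \<open>0\<close>
    while the threshold \<open>Suc D - z\<close> rises from \<open>1\<close> to
    \<open>Suc D\<close>.\<close>
  define J where "J z s \<longleftrightarrow>
    (\<exists>y k p. st x y z k p (\<lambda>lv mk. levels X 0 0 lv \<and> marks lv (Suc D - z) 0 mk) s)" for z s
  let ?body = "Seq (Sub 11 9 12) (Seq (fds_prog mark_step) (Sub 12 12 1))"
  have "triple (J D) (While 12 ?body) (J 0)"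
  proof (rule hoare_While)
    fix z assume z: "Suc z \<le> D"
    show "triple (J (Suc z)) ?body (J z)"
    proof -
      let ?B = "\<lambda>s. \<exists>k p. st x (D - z) (Suc z) k p (\<lambda>lv mk. levels X 0 0 lv \<and> marks lv (D - z) 0 mk) s"
      let ?C = "st x (D - z) (Suc z) 0 (addr m) (\<lambda>lv mk. levels X 0 0 lv \<and> marks lv (D - z) m mk)"
      have 1: "triple (J (Suc z)) (Sub 11 9 12) ?B"
        by (rule hoare_run) (auto simp: J_def st_def regs_def)
      have 2: "triple ?B (fds_prog mark_step) ?C"
        using z by (intro mark_step_correct) auto
      have nxt: "marks lv (Suc D - z) 0 mk" if "marks lv (D - z) m mk" for lv mk
        using marks_next[OF that] z by (simp add: Suc_diff_le)
      have 3: "triple ?C (Sub 12 12 1) (J z)"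
      proof (rule hoare_run)
        fix R M assume "?C (R, M)"
        then have "st x (D - z) (Suc z) 0 (addr m)
            (\<lambda>lv mk. levels X 0 0 lv \<and> marks lv (Suc D - z) 0 mk) (R, M)"
          by (rule st_mono) (simp add: nxt)
        then show "J z (run (Sub 12 12 1) (R, M))"
          by (auto simp: J_def st_def regs_def)
      qed simp
      show ?thesis by (rule hoare_Seq[OF 1 hoare_Seq[OF 2 3]])
    qed
  qed (use L_bounds in \<open>auto simp: J_def st_def regs_def\<close>)
  note loop = this
  have "triple (\<lambda>s. \<exists>y z k p. st x y z k p (\<lambda>lv mk. levels X 0 0 lv \<and> marks lv 1 0 mk) s)
      (Add 12 3 0) (J D)"
    by (rule hoare_run) (auto simp: J_def st_def regs_def)
  from hoare_Seq[OF this loop] show ?thesis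
    unfolding mark_prog_def by (rule hoare_conseq) (auto simp: J_def)
qed

text \<open>Marked attributes join the solution and levels of merely inferred attributes are erased;
  under \<open>levels X 0 0 lv\<close>, the test \<open>D < lv j\<close> singles out the members of
  \<open>X\<close>.\<close>

lemma reset_correct:
  "triple (\<lambda>(R, M). regs x y z k p R \<and> M = mem lv mk) reset_prog
    (st x y z k p (\<lambda>lv' mk'. \<forall>j \<in> V. mk' j = 0 \<and>
       lv' j = (if mk j \<noteq> 0 then Suc D else if D < lv j then lv j else 0)))"
proof -
  define upd where "upd j = (if mk j \<noteq> 0 then Suc D else if D < lv j then lv j else 0)" for j
  define J where "J j s \<longleftrightarrow> fst s 15 = j \<and> j \<le> n \<and> st x y z k p (\<lambda>lv' mk'. \<forall>i \<in> V.
    (if i \<le> j then lv' i = lv i \<and> mk' i = mk i else lv' i = upd i \<and> mk' i = 0)) s" for j s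
  have "triple (J n) (While 15 reset_body) (J 0)"
  proof (rule hoare_While)
    fix j assume j: "Suc j \<le> n"
    show "triple (J (Suc j)) reset_body (J j)"
    proof (rule hoare_run)
      fix R M assume "J (Suc j) (R, M)"
      then obtain lv' mk' where R: "R 15 = Suc j" "regs x y z k p R" "M = mem lv' mk'"
        and I: "\<forall>i \<in> V. (if i \<le> Suc j then lv' i = lv i \<and> mk' i = mk i else lv' i = upd i \<and> mk' i = 0)"
        by (auto simp: J_def st_def)
      have eq: "lv' (Suc j) = lv (Suc j)" "mk' (Suc j) = mk (Suc j)" using I j by auto
      define lv'' where "lv'' = lv'(Suc j := upd (Suc j))"
      have I': "\<forall>i \<in> V. (if i \<le> j then lv'' i = lv i \<and> (mk'(Suc j := 0)) i = mk i
          else lv'' i = upd i \<and> (mk'(Suc j := 0)) i = 0)"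
      proof
        fix i assume "i \<in> V"
        with I have "if i \<le> Suc j then lv' i = lv i \<and> mk' i = mk i else lv' i = upd i \<and> mk' i = 0"
          by blast
        then show "if i \<le> j then lv'' i = lv i \<and> (mk'(Suc j := 0)) i = mk i
            else lv'' i = upd i \<and> (mk'(Suc j := 0)) i = 0"
          by (cases "i = Suc j") (auto simp: lv''_def split: if_splits)
      qed
      note mem = mem_lv[of "Suc j"] mem_mk[of "Suc j"] mem_upd_lv[of "Suc j"] mem_upd_mk[of "Suc j"]
      have "regs x y z k p (fst (run reset_body (R, M)))" "fst (run reset_body (R, M)) 15 = j"
        using R by (simp_all add: reset_body_def regs_def)
      moreover have "snd (run reset_body (R, M)) = mem lv'' (mk'(Suc j := 0))"
      proof -
        have "lv'(Suc j := lv (Suc j)) = lv'" using eq by (simp add: fun_upd_idem)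
        then show ?thesis
          using R eq j mem unfolding lv''_def upd_def
          by (simp add: reset_body_def regs_def del: add_Suc_right)
      qed
      ultimately show "J j (run reset_body (R, M))"
        unfolding J_def st_def using I' j by (intro conjI exI) (assumption | simp)+
    qed (simp add: reset_body_def)
  qed (use L_bounds in \<open>auto simp: J_def\<close>)
  note loop = this
  have "triple (\<lambda>(R, M). regs x y z k p R \<and> M = mem lv mk) (Add 15 2 0) (J n)"
    by (rule hoare_run) (auto simp: J_def st_def regs_def)
  from hoare_Seq[OF this loop] show ?thesis
    unfolding reset_prog_def
  proof (rule hoare_conseq)
    fix s assume "J 0 s"
    then have "st x y z k p (\<lambda>lv' mk'. \<forall>i \<in> V. (if i \<le> 0 then lv' i = lv i \<and> mk' i = mk i
        else lv' i = upd i \<and> mk' i = 0)) s"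
      by (simp only: J_def)
    then show "st x y z k p (\<lambda>lv' mk'. \<forall>j \<in> V. mk' j = 0 \<and>
        lv' j = (if mk j \<noteq> 0 then Suc D else if D < lv j then lv j else 0)) s"
      by (rule st_mono) (auto simp: upd_def)
  qed
qed

section \<open>Accounting over all repetitions\<close>

definition partial_solution :: "nat \<Rightarrow> nat set \<Rightarrow> bool" where
  "partial_solution i X \<longleftrightarrow> X \<subseteq> V \<and> (feasible D n F T X \<or> i \<le> card X) \<and>
     (\<forall>Z. feasible D n F T Z \<longrightarrow> card X \<le> (f + 1) ^ D * card (Z \<inter> X))"

definition stores :: "nat set \<Rightarrow> (nat \<Rightarrow> nat) \<Rightarrow> (nat \<Rightarrow> nat) \<Rightarrow> bool" where
  "stores X lv mk \<longleftrightarrow> (\<forall>j \<in> V. mk j = 0 \<and> lv j = (if j \<in> X then Suc D else 0))"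

text \<open>The disjoint pieces added so far need not be remembered: each has at most
  \<open>(f + 1) ^ D\<close> elements and meets every feasible \<open>Z\<close>, so the inequality
  for \<open>card X\<close> is additive. A repetition on an infeasible \<open>X\<close> adds at
  least one attribute, which gives the progress clause.\<close>

lemma partial_solution_next:
  assumes lv: "levels X 0 0 lv" and mk: "marks lv (Suc D) 0 mk" and X: "partial_solution i X"
  shows "partial_solution (Suc i) (X \<union> {j \<in> V. mk j \<noteq> 0})"
proof -
  define C where "C = {j \<in> V. mk j \<noteq> 0}"
  have XV: "X \<subseteq> V" using X by (simp add: partial_solution_def)
  note C = marks_result[OF lv mk XV, folded C_def]
  have fin: "finite X" "finite C" using XV finite_subset by (auto simp: C_def)
  have "partial_solution (Suc i) (X \<union> C)"
  proof (cases "C = {}")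
    case True
    then show ?thesis using C(3) X by (simp add: partial_solution_def)
  next
    case False
    then have "card C \<ge> 1" using fin by (simp add: Suc_leI card_gt_0_iff)
    have card: "card (X \<union> C) = card X + card C"
      using fin C(1) by (intro card_Un_disjoint) auto
    have "feasible D n F T (X \<union> C) \<or> Suc i \<le> card (X \<union> C)"
    proof (cases "feasible D n F T X")
      case True
      \<comment> \<open>A feasible \<open>X\<close> would itself have to meet a nonempty
        \<open>C\<close>, but the two are disjoint.\<close>
      then have "C = {}" using C(4)[of X] C(1) by auto
      then show ?thesis using False by simp
    next
      case nf: False
      then show ?thesis using X card \<open>card C \<ge> 1\<close> by (auto simp: partial_solution_def)
    qed
    moreover have "card (X \<union> C) \<le> (f + 1) ^ D * card (Z \<inter> (X \<union> C))" if Z: "feasible D n F T Z" for Z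
    proof -
      have "1 \<le> card (Z \<inter> C)"
        using C(4)[OF False Z] fin by (simp add: Suc_leI card_gt_0_iff)
      then have "card C \<le> (f + 1) ^ D * card (Z \<inter> C)"
        using C(2) by (metis le_trans mult.right_neutral mult_le_mono2)
      moreover have "card X \<le> (f + 1) ^ D * card (Z \<inter> X)"
        using X Z by (simp add: partial_solution_def)
      moreover have "card (Z \<inter> (X \<union> C)) = card (Z \<inter> X) + card (Z \<inter> C)"
        unfolding Int_Un_distrib using fin C(1) by (intro card_Un_disjoint) auto
      ultimately show ?thesis by (simp add: card distrib_left)
    qed
    moreover have "X \<union> C \<subseteq> V" using XV by (auto simp: C_def)
    ultimately show ?thesis by (simp add: partial_solution_def)
  qed
  then show ?thesis by (simp only: C_def)
qed

lemma body_correct: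
  assumes X: "partial_solution i X"
  shows "triple (\<lambda>s. \<exists>y z k p. st (Suc x) y z k p (stores X) s) main_body
    (\<lambda>s. \<exists>y z k p X. partial_solution (Suc i) X \<and> st x y z k p (stores X) s)"
    (is "triple ?P _ ?Q")
proof -
  let ?A = "\<lambda>s. \<exists>y z k p. st (Suc x) y z k p (\<lambda>lv mk. levels X 0 0 lv \<and> marks lv (Suc D) 0 mk) s"
  let ?B = "\<lambda>s. \<exists>y z k p X. partial_solution (Suc i) X \<and> st (Suc x) y z k p (stores X) s"
  have reset: "triple ?A reset_prog ?B"
  proof (rule hoare_cases)
    fix R M assume "?A (R, M)"
    then obtain y z k p lv mk where s: "regs (Suc x) y z k p R" "M = mem lv mk"
      and lv: "levels X 0 0 lv" and mk: "marks lv (Suc D) 0 mk"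
      by (auto simp: st_def)
    define X' where "X' = X \<union> {j \<in> V. mk j \<noteq> 0}"
    have "(if mk j \<noteq> 0 then Suc D else if D < lv j then lv j else 0) = (if j \<in> X' then Suc D else 0)"
      if "j \<in> V" for j
      using levelsD(1,2)[OF lv that] that unfolding X'_def by (cases "lv j = 0") auto
    then have st: "st (Suc x) y z k p (stores X') s" if "st (Suc x) y z k p (\<lambda>lv' mk'. \<forall>j \<in> V. mk' j = 0 \<and>
       lv' j = (if mk j \<noteq> 0 then Suc D else if D < lv j then lv j else 0)) s" for s
      using that unfolding st_def stores_def by (metis (no_types, lifting))
    then have "triple (\<lambda>(R, M). regs (Suc x) y z k p R \<and> M = mem lv mk) reset_prog ?B"
      using partial_solution_next[OF lv mk X, folded X'_def]
      by (intro hoare_conseq[OF reset_correct]) (assumption, blast intro: st)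
    then show "\<exists>P. P (R, M) \<and> triple P reset_prog ?B"
      using s by (intro exI conjI) auto
  qed
  have finish: "triple ?B (Sub 10 10 1) ?Q"
    by (rule hoare_run) (fastforce simp: st_def regs_def)+
  have infer: "triple ?P infer_prog
    (\<lambda>s. \<exists>y z k p. st (Suc x) y z k p (\<lambda>lv mk. levels X 0 0 lv \<and> (\<forall>j \<in> V. mk j = 0)) s)"
  proof (rule hoare_conseq[OF infer_correct])
    fix s assume "?P s"
    then obtain y z k p where "st (Suc x) y z k p (stores X) s" by blast
    moreover have "levels X D 0 lv \<and> (\<forall>j \<in> V. mk j = 0)" if "stores X lv mk" for lv mk
      using that levels_init unfolding stores_def by blast
    ultimately have "st (Suc x) y z k p (\<lambda>lv mk. levels X D 0 lv \<and> (\<forall>j \<in> V. mk j = 0)) s"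
      by (rule st_mono)
    then show "\<exists>y z k p. st (Suc x) y z k p (\<lambda>lv mk. levels X D 0 lv \<and> (\<forall>j \<in> V. mk j = 0)) s"
      by (intro exI)
  qed
  show ?thesis
    unfolding main_body_def
    by (rule hoare_Seq[OF infer hoare_Seq[OF target_correct[of "Suc x" X]
      hoare_Seq[OF mark_correct[of "Suc x" X]
      hoare_Seq[OF reset finish]]]])
qed

lemma output_correct:
  "triple (\<lambda>s. \<exists>y z k p. st x y z k p (stores X) s) output_prog (\<lambda>s. result s = bits n X)"
    (is "triple ?P _ _")
proof -
  \<comment> \<open>The output overwrites the input, so this invariant drops the form
    \<open>mem lv mk\<close>; the array at \<open>L\<close> is safe because only cells up to
    \<open>n < L\<close> are written.\<close>
  define J :: "nat \<Rightarrow> state \<Rightarrow> bool" where "J j s \<longleftrightarrow> fst s 0 = 0 \<and> fst s 1 = 1 \<and> fst s 2 = n \<and> fst s 4 = L \<and> fst s 15 = j \<and> j \<le> n \<and>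
    (\<forall>i \<in> V. snd s (L + i) = (if i \<in> X then Suc D else 0)) \<and>
    (\<forall>i \<in> V. j < i \<longrightarrow> snd s i = (if i \<in> X then 1 else 0))" for j s
  have n: "n < L" by (simp add: L_eq)
  have "triple (J n) (While 15 output_body) (J 0)"
  proof (rule hoare_While)
    fix j assume j: "Suc j \<le> n"
    show "triple (J (Suc j)) output_body (J j)"
    proof (rule hoare_run)
      fix R M assume J: "J (Suc j) (R, M)"
      have "M (L + Suc j) = (if Suc j \<in> X then Suc D else 0)"
        using J j unfolding J_def by (auto simp del: add_Suc_right)
      moreover have "j < i \<longleftrightarrow> i = Suc j \<or> Suc j < i" for i by auto
      ultimately show "J j (run output_body (R, M))"
        using J n j unfolding J_def output_body_def by (auto simp del: add_Suc_right)
    qed (simp add: output_body_def)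
  qed (use L_bounds in \<open>auto simp: J_def\<close>)
  moreover have "triple ?P (Add 15 2 0) (J n)"
  proof (rule hoare_run)
    fix R M assume "?P (R, M)"
    then obtain y z k p lv mk where "regs x y z k p R" "M = mem lv mk" "stores X lv mk"
      by (auto simp: st_def)
    moreover from this have "\<forall>i \<in> V. M (L + i) = (if i \<in> X then Suc D else 0)"
      by (simp add: stores_def)
    ultimately show "J n (run (Add 15 2 0) (R, M))"
      by (simp add: J_def regs_def)
  qed simp
  moreover have "triple (J 0) (Store 0 2) (\<lambda>s. result s = bits n X)"
    by (rule hoare_run) (auto simp: J_def result_def bits_def)
  ultimately show ?thesis
    unfolding output_prog_def by (intro hoare_Seq)
qed

lemma setup_correct:
  "triple (\<lambda>s. s = init_state w) setup_prog (\<lambda>s. \<exists>y z k p. st n y z k p (stores {}) s)"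
proof (rule hoare_run)
  fix R M assume "(R, M) = init_state w"
  then have R: "R = (\<lambda>_. 0)" and M: "M = snd (init_state w)" by (auto simp: init_state_def)
  \<comment> \<open>The memory behind the input is zero, which already represents the empty solution
    without marks.\<close>
  have "M = mem (\<lambda>_. 0) (\<lambda>_. 0)"
    unfolding M by (auto simp: fun_eq_iff mem_def init_state_def L_def)
  moreover have "stores {} (\<lambda>_. 0) (\<lambda>_. 0)" by (simp add: stores_def)
  ultimately show "\<exists>y z k p. st n y z k p (stores {}) (run setup_prog (R, M))"
    unfolding st_def using R mem_header[of "\<lambda>_. 0" "\<lambda>_. 0"]
    by (auto simp: setup_prog_def regs_def addr_def add.commute)
qed (simp add: setup_prog_def)

lemma tcand_correct:
  "triple (\<lambda>s. s = init_state w) tcand_prog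
    (\<lambda>s. \<exists>X. feasible D n F T X \<and> card X \<le> (f + 1) ^ D * opt D n F T \<and> result s = bits n X)"
    (is "triple _ _ ?Q")
proof -
  define J where "J x s \<longleftrightarrow> x \<le> n \<and>
    (\<exists>y z k p X. partial_solution (n - x) X \<and> st x y z k p (stores X) s)" for x s
  have "triple (J n) (While 10 main_body) (J 0)"
  proof (rule hoare_While)
    fix x assume x: "Suc x \<le> n"
    show "triple (J (Suc x)) main_body (J x)"
    proof (rule hoare_cases)
      fix R M assume "J (Suc x) (R, M)"
      then obtain X where X: "partial_solution (n - Suc x) X"
        "\<exists>y z k p. st (Suc x) y z k p (stores X) (R, M)"
        unfolding J_def by blast
      have "Suc (n - Suc x) = n - x" using x by simp
      then have "triple (\<lambda>s. \<exists>y z k p. st (Suc x) y z k p (stores X) s) main_body (J x)"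
        using x body_correct[OF X(1), of x] unfolding J_def by (elim hoare_conseq) auto
      with X(2) show "\<exists>P. P (R, M) \<and> triple P main_body (J x)"
        by (intro exI conjI)
    qed
  qed (use L_bounds in \<open>auto simp: J_def st_def regs_def\<close>)
  moreover have "triple (J 0) output_prog ?Q"
  proof (rule hoare_cases)
    fix R M assume "J 0 (R, M)"
    then obtain X where X: "partial_solution n X" "\<exists>y z k p. st 0 y z k p (stores X) (R, M)"
      unfolding J_def diff_zero by blast
    have XV: "X \<subseteq> V" using X by (simp add: partial_solution_def)
    \<comment> \<open>After \<open>n\<close> repetitions an infeasible \<open>X\<close> would have
      \<open>n\<close> elements and equal \<open>V\<close>, which infers every target in zero
      rounds.\<close>
    have feas: "feasible D n F T X"
    proof (rule ccontr)
      assume nf: "\<not> feasible D n F T X"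
      then have "card V \<le> card X"
        using X(1) by (simp add: partial_solution_def)
      then have "X = V" using XV by (intro card_seteq) auto
      then show False
        using nf T_subset infer_superset[of V F D] by (auto simp: feasible_def)
    qed
    obtain Z where Z: "feasible D n F T Z" "card Z = opt D n F T"
      using opt_attained(1)[OF T_subset] by blast
    have "card X \<le> (f + 1) ^ D * card (Z \<inter> X)"
      using X(1) Z(1) by (simp add: partial_solution_def)
    also have "\<dots> \<le> (f + 1) ^ D * opt D n F T"
    proof -
      have "finite Z" using Z(1) finite_subset by (auto simp: feasible_def)
      then have "card (Z \<inter> X) \<le> card Z" by (intro card_mono) auto
      then show ?thesis by (simp add: Z(2))
    qed
    finally have "triple (\<lambda>s. \<exists>y z k p. st 0 y z k p (stores X) s) output_prog ?Q"
      using feas by (intro hoare_conseq[OF output_correct]) auto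
    with X(2) show "\<exists>P. P (R, M) \<and> triple P output_prog ?Q"
      by (intro exI conjI)
  qed
  moreover have "partial_solution 0 {}"
    by (simp add: partial_solution_def)
  then have "triple (\<lambda>s. s = init_state w) setup_prog (J n)"
    unfolding J_def by (intro hoare_conseq[OF setup_correct]) (assumption, simp, blast)
  ultimately show ?thesis
    unfolding tcand_prog_def by (intro hoare_Seq)
qed

lemma tcand_exec:
  obtains t s X where "exec tcand_prog (init_state (encode D n fs T)) t s"
    "t \<le> steps (Suc (length (encode D n fs T))) tcand_prog"
    "feasible D n F T X" "card X \<le> (max_fds n F + 1) ^ D * opt D n F T" "result s = bits n X"
  using tcand_correct unfolding hoare_def w_def L_def f_def by blast

end

theorem theorem5:
  "\<exists>A. poly_time_on tcand_inputs A \<and>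
       tcand_approximation (\<lambda>D n F T. (real (max_fds n F) + 1) ^ D) A"
proof (intro exI conjI)
  obtain p :: "nat poly" where p: "\<forall>K. steps K tcand_prog = poly p K"
    using steps_poly by blast
  show "poly_time_on tcand_inputs tcand_prog"
    unfolding poly_time_on_def
  proof (rule exI, rule ballI)
    fix w assume "w \<in> tcand_inputs"
    then obtain D n fs T where w: "w = encode D n fs T" and "tcand D n fs T"
      by (auto simp: tcand_inputs_def tcand_def)
    then interpret tcand D n fs T by simp
    obtain t s where "exec tcand_prog (init_state (encode D n fs T)) t s"
      "t \<le> steps (Suc (length (encode D n fs T))) tcand_prog"
      using tcand_exec by blast
    \<comment> \<open>Composition with \<open>[:1, 1:]\<close> evaluates \<open>p\<close> at the
      input length plus one, the loop bound used throughout.\<close>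
    then show "\<exists>t s. exec tcand_prog (init_state w) t s \<and> t \<le> poly (pcompose p [:1, 1:]) (length w)"
      using p unfolding w by (intro exI[of _ t] exI[of _ s]) (simp add: poly_pcompose)
  qed
  show "tcand_approximation (\<lambda>D n F T. (real (max_fds n F) + 1) ^ D) tcand_prog"
    unfolding tcand_approximation_def
  proof (intro allI impI)
    fix D n fs T assume "tcand_instance D n (set fs) T \<and> distinct fs"
    then interpret tcand D n fs T by unfold_locales auto
    obtain t s X where X: "exec tcand_prog (init_state (encode D n fs T)) t s"
      "feasible D n (set fs) T X" "card X \<le> (max_fds n (set fs) + 1) ^ D * opt D n (set fs) T" "result s = bits n X"
      using tcand_exec by blast
    have "real (card X) \<le> real ((max_fds n (set fs) + 1) ^ D * opt D n (set fs) T)"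
      using X(3) of_nat_mono by blast
    then show "\<exists>X. outputs tcand_prog (encode D n fs T) (bits n X) \<and> feasible D n (set fs) T X \<and>
        real (card X) \<le> (real (max_fds n (set fs)) + 1) ^ D * real (opt D n (set fs) T)"
      using X unfolding outputs_def
      by (intro exI[of _ X] conjI exI[of _ t] exI[of _ s]) (simp_all add: add.commute)
  qed
qed

end
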